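(* Let $m$ be an integer such that $q=4m^2+4m+3$ is a prime power, and put $n=q+1=4(m^2+m+1)$. Then there exists a biregular Hadamard matrix of order $n$ with maximum excess, i.e. whose excess equals the upper bound $n(t+4)-4s$ described in the context. In particular, the Hadamard matrix \[ H=\begin{pmatrix} -1 & \mathbf{1}_q^{\top} \\ \mathbf{1}_q & M\end{pmatrix} \] (where $M$ is the $q\times q$ matrix with rows and columns indexed by $\mathbb{F}_q$ and $M_{i,j}=1$ if $j-i$ is a square in $\mathbb{F}_q$ (including $0$) and $M_{i,j}=-1$ otherwise) can be transformed into a biregular Hadamard matrix with maximum excess by multiplying some of its rows and some of its columns by $-1$.
   Context: An Hadamard matrix of order $n$ is an $n\times n$ matrix $H$ with entries in $\{1,-1\}$ such that $HH^{\top}=nI_n$. Its excess $E(H)$ is the sum of all its entries. $\mathbf{1}_n$ is the all-one column vector of length $n$. $H$ is called biregular if the entries of $H\mathbf{1}_n$ take exactly two values, both nonnegative integers. Known upper bound on the excess: let $k$ be the even integer with $k\le\sqrt{n}<k+2$; put $t=k$ if $|n-k^2|<|n-(k+2)^2|$ and $t=k-2$ otherwise; let $s$ be the integer part of $n((t+4)^2-n)/(8t+16)$. Then every Hadamard matrix $H$ of order $n$ satisfies $E(H)\le n(t+4)-4s$; "maximum excess" means $E(H)=n(t+4)-4s$. For $q\equiv 3 \pmod 4$ the matrix $H$ in the claim is an Hadamard matrix of order $q+1$.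
   Formalization: For q = 3 (m = 0 or −1, n = 4) biregularity is not claimed, since a Hadamard matrix of order 4 with maximum excess 8 has all row sums equal to 2; there only the Hadamard property and maximum excess are asserted. *)

theory Defs
  imports
    Complex_Main
    "HOL-Algebra.Ring"
    "HOL-Number_Theory.Prime_Powers"
    "Jordan_Normal_Form.Matrix"
begin

definition hadamard_mat :: "nat \<Rightarrow> int mat \<Rightarrow> bool" where
  "hadamard_mat n H \<longleftrightarrow>
     H \<in> carrier_mat n n \<and> elements_mat H \<subseteq> {1, -1} \<and>
     H * transpose_mat H = int n \<cdot>\<^sub>m 1\<^sub>m n"

definition excess :: "int mat \<Rightarrow> int" where
  "excess H = (\<Sum>i<dim_row H. \<Sum>j<dim_col H. H $$ (i, j))"

(* A Hadamard matrix of order 4 with the maximum excess 8 has all row sums equal to 2: the squares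
   of its row sums add up to 16, so Cauchy-Schwarz is an equality. It is therefore never biregular,
   which is why the case q = 3, n = q + 1 = 4 has to be treated separately. *)
definition biregular :: "int mat \<Rightarrow> bool" where
  "biregular H \<longleftrightarrow>
     (let V = vec_set (H *\<^sub>v vec (dim_col H) (\<lambda>_. 1))
      in card V = 2 \<and> (\<forall>v\<in>V. 0 \<le> v))"

definition bound_k :: "nat \<Rightarrow> int" where
  "bound_k n = (THE k. even k \<and> real_of_int k \<le> sqrt (real n) \<and> sqrt (real n) < real_of_int k + 2)"

definition bound_t :: "nat \<Rightarrow> int" where
  "bound_t n =
     (let k = bound_k n
      in if \<bar>int n - k\<^sup>2\<bar> < \<bar>int n - (k + 2)\<^sup>2\<bar> then k else k - 2)"

(* For n = 2 and n = 3 one gets t = -2 and a zero denominator; for n >= 4 one has t >= 0. *)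
definition bound_s :: "nat \<Rightarrow> int" where
  "bound_s n =
     (let t = real_of_int (bound_t n)
      in \<lfloor>real n * ((t + 4)\<^sup>2 - real n) / (8 * t + 16)\<rfloor>)"

definition excess_bound :: "nat \<Rightarrow> int" where
  "excess_bound n = int n * (bound_t n + 4) - 4 * bound_s n"

lemma bound_k_ex1:
  "\<exists>!k::int. even k \<and> real_of_int k \<le> sqrt (real n) \<and> sqrt (real n) < real_of_int k + 2"
proof (rule ex1I)
  show "even (2 * \<lfloor>sqrt (real n) / 2\<rfloor>) \<and>
      real_of_int (2 * \<lfloor>sqrt (real n) / 2\<rfloor>) \<le> sqrt (real n) \<and>
      sqrt (real n) < real_of_int (2 * \<lfloor>sqrt (real n) / 2\<rfloor>) + 2"
    using floor_correct[of "sqrt (real n) / 2"] by (auto simp: field_simps)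
next
  fix k :: int
  assume k: "even k \<and> real_of_int k \<le> sqrt (real n) \<and> sqrt (real n) < real_of_int k + 2"
  then obtain l where l: "k = 2 * l" by (auto elim: evenE)
  with k have "\<lfloor>sqrt (real n) / 2\<rfloor> = l" by (intro floor_unique) auto
  with l show "k = 2 * \<lfloor>sqrt (real n) / 2\<rfloor>" by simp
qed

(* The finite field F is listed as e 0, ..., e (q - 1); its elements index the rows and columns.
   The entry depends on whether e j - e i is a square of F, with 0 counted as a square. *)
definition square_mat_of_field :: "('a, 'b) ring_scheme \<Rightarrow> nat \<Rightarrow> (nat \<Rightarrow> 'a) \<Rightarrow> int mat" where
  "square_mat_of_field F q e =
     mat q q (\<lambda>(i, j).
       if \<exists>y\<in>carrier F. e j \<ominus>\<^bsub>F\<^esub> e i = y \<otimes>\<^bsub>F\<^esub> y then 1 else - 1)"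

definition bordered_mat_of_field :: "('a, 'b) ring_scheme \<Rightarrow> nat \<Rightarrow> (nat \<Rightarrow> 'a) \<Rightarrow> int mat" where
  "bordered_mat_of_field F q e =
     four_block_mat (mat 1 1 (\<lambda>_. - 1)) (mat 1 q (\<lambda>_. 1))
                    (mat q 1 (\<lambda>_. 1)) (square_mat_of_field F q e)"

definition negate_rows_cols :: "nat set \<Rightarrow> nat set \<Rightarrow> int mat \<Rightarrow> int mat" where
  "negate_rows_cols R C H =
     mat (dim_row H) (dim_col H) (\<lambda>(i, j).
       (if i \<in> R then - 1 else 1) * (if j \<in> C then - 1 else 1) * H $$ (i, j))"

end

theory Submission
  imports
    "HOL-Algebra.Algebraic_Closure"
    "HOL-Algebra.Multiplicative_Group"
    "HOL-Number_Theory.Residues"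
    Defs
begin

text \<open>
  After negating its first row, the bordered matrix is \<open>I + S\<close> with \<open>S\<close> the skew matrix
  \<open>\<eta> (det (u, v))\<close> indexed by the points of the projective line over \<open>F\<close>. Identify the plane
  with \<open>K = F[\<surd>- 1]\<close>, so that the determinant is the imaginary part of \<open>cj u * v\<close>, fix a generator
  \<open>g\<close> of the multiplicative group of \<open>K\<close>, and choose the signs \<open>x\<close> of the columns as a function of
  the exponent of \<open>g\<close> modulo 8 that changes sign under a shift by 4. Since \<open>q + 1\<close> is 4 modulo 8,
  \<open>(I + S) x\<close> is a function of the same kind, determined by two integers \<open>A\<close> and \<open>B\<close> (the sums of
  \<open>\<eta> (Im g\<^sup>i)\<close> over the exponents congruent to 1 and to 2 modulo 4, suitably signed), and
  orthogonality gives \<open>B\<^sup>2 + 2 A\<^sup>2 = q = (2 m + 1)\<^sup>2 + 2\<close>. Reducing a Gauss-type sum modulo the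
  characteristic \<open>p\<close> turns it into a binomial coefficient which is prime to \<open>p\<close> by Lucas' theorem; so
  \<open>p\<close> does not divide both \<open>A\<close> and \<open>B\<close>, whence \<open>A = \<plusminus>1\<close> and \<open>B = \<plusminus>(2 m + 1)\<close>. For a suitable sign
  pattern all entries of \<open>(I + S) x\<close> are then \<open>\<plusminus>(2 m - 2)\<close> or \<open>\<plusminus>(2 m + 2)\<close>, and the sum of their
  squares, which is \<open>n\<^sup>2\<close>, determines how often each value occurs.
\<close>

text \<open>The equation B^2 + 2 A^2 = q does not by itself determine A and B when q is a proper
  prime power: for m = 2 one has 27 = 5^2 + 2 = 3^2 + 2 * 3^2. The imprimitive solutions are what
  the reduction modulo p has to exclude. It works because K contains an element \<zeta> of order 8,
  as 8 divides q^2 - 1: the sum of \<open>phi i\<close> times \<zeta>^(-i) is a combination of A and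
  B with coefficients in K, hence zero if p divides both. Euler's criterion makes
  \<open>phi i\<close> a power of the imaginary part of z = g^i, which is (z - cj z) / (2 sqrt(-1))
  with cj z = z^q; so the same sum, taken over the roots of unity of order dividing q + 1, extracts
  one coefficient of (1 - X)^((q-1)/2). That S is skew and that K is a field both rest on - 1 being
  a nonsquare, that is, on q being 3 modulo 4. That q is even 3 modulo 8 makes (q + 1) / 4 odd, so
  that \<open>phi\<close> and the sign pattern change sign together under a shift by q + 1 and their
  product is well defined on the projective line.\<close>

lemma (in abelian_group) add_pow_card_carrier:
  assumes "x \<in> carrier G"
  shows "[(card (carrier G))] \<cdot> x = \<zero>"
  using group.pow_order_eq_1[OF a_group, of x] assms by (simp add: add_pow_def order_def)

lemma (in ring) add_pow_coprime_imp_trivial: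
  fixes a b :: nat
  assumes "coprime a b" "[a] \<cdot> \<one> = \<zero>" "[b] \<cdot> \<one> = \<zero>"
  shows "\<one> = \<zero>"
proof (cases "b = 1")
  case True
  then show ?thesis using assms by simp
next
  case False
  then obtain x y where xy: "a * x = b * y + 1"
    using coprime_bezout_strong assms by blast
  have "[(a * x)] \<cdot> \<one> = [x] \<cdot> ([a] \<cdot> \<one>)" by (simp add: add.nat_pow_pow)
  moreover have "[(b * y + 1)] \<cdot> \<one> = [y] \<cdot> ([b] \<cdot> \<one>) \<oplus> \<one>"
    by (simp add: add.nat_pow_pow flip: add.nat_pow_mult)
  ultimately show ?thesis using assms xy by simp
qed

text \<open>The sign (-1)^i for exponents i that are integers, often negative ones.\<close>

definition parity_sign :: "int \<Rightarrow> int" where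
  "parity_sign i = (if even i then 1 else - 1)"

lemma parity_sign_minus [simp]: "parity_sign (- i) = parity_sign i"
  by (simp add: parity_sign_def)

lemma alternating_parity_sign:
  fixes h :: "int \<Rightarrow> int"
  assumes "\<And>z. h (z + 1) = - h z"
  shows "h z = parity_sign z * h 0"
proof (induction z rule: int_induct[where k = 0])
  case (step1 z)
  then show ?case using assms[of z] by (simp add: parity_sign_def)
next
  case (step2 z)
  then show ?case using assms[of "z - 1"] by (simp add: parity_sign_def split: if_splits)
qed (simp add: parity_sign_def)

section \<open>Finite fields of prime power order\<close>

lemma (in cring) binomial_pow:
  assumes x: "x \<in> carrier R"
  shows "(\<one> \<oplus> x) [^] (n::nat) = (\<Oplus>k\<in>{..n}. [(n choose k)] \<cdot> (x [^] k))"
proof (induction n)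
  case 0
  then show ?case by simp
next
  case (Suc n)
  have c[simp]: "(\<lambda>k. [(f k)] \<cdot> (x [^] g k)) \<in> A \<rightarrow> carrier R" for f g :: "nat \<Rightarrow> nat" and A
    using x by auto
  have comm: "a \<oplus> \<one> \<oplus> b = a \<oplus> b \<oplus> \<one>" if "a \<in> carrier R" "b \<in> carrier R" for a b
    using that by algebra
  have "(\<one> \<oplus> x) [^] Suc n = (\<one> \<oplus> x) [^] n \<oplus> (\<one> \<oplus> x) [^] n \<otimes> x"
    using x by (simp add: r_distr)
  also have "(\<one> \<oplus> x) [^] n \<otimes> x = (\<Oplus>k\<in>{..n}. [(n choose k)] \<cdot> (x [^] Suc k))"
    unfolding Suc.IH using x by (subst finsum_ldistr) (auto simp: add_pow_ldistr intro!: finsum_cong')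
  also have "(\<one> \<oplus> x) [^] n = (\<Oplus>k\<in>{..Suc n}. [(n choose k)] \<cdot> (x [^] k))"
    unfolding Suc.IH using x by (simp add: binomial_eq_0)
  also have "\<dots> = (\<Oplus>k\<in>{..n}. [(n choose Suc k)] \<cdot> (x [^] Suc k)) \<oplus> \<one>"
    using x by (subst finsum_Suc2) auto
  also have "\<dots> \<oplus> (\<Oplus>k\<in>{..n}. [(n choose k)] \<cdot> (x [^] Suc k)) =
      ((\<Oplus>k\<in>{..n}. [(n choose Suc k)] \<cdot> (x [^] Suc k)) \<oplus> (\<Oplus>k\<in>{..n}. [(n choose k)] \<cdot> (x [^] Suc k))) \<oplus> \<one>"
    using x by (intro comm) (auto intro!: finsum_closed)
  also have "(\<Oplus>k\<in>{..n}. [(n choose Suc k)] \<cdot> (x [^] Suc k)) \<oplus> (\<Oplus>k\<in>{..n}. [(n choose k)] \<cdot> (x [^] Suc k)) =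
      (\<Oplus>k\<in>{..n}. [(Suc n choose Suc k)] \<cdot> (x [^] Suc k))"
    using x by (subst finsum_addf[symmetric]) (auto simp: add.nat_pow_mult add.m_comm intro!: finsum_cong')
  also have "\<dots> \<oplus> \<one> = (\<Oplus>k\<in>{..Suc n}. [(Suc n choose k)] \<cdot> (x [^] k))"
    using x finsum_Suc2[of "\<lambda>k. [(Suc n choose k)] \<cdot> (x [^] k)" n] by (simp del: nat_pow_Suc binomial_Suc_Suc finsum_Suc)
  finally show ?case .
qed

lemma (in field) freshmans_dream:
  assumes p: "prime (p::nat)" "[p] \<cdot> \<one> = \<zero>" and x: "x \<in> carrier R" and y: "y \<in> carrier R"
  shows "(x \<oplus> y) [^] p = x [^] p \<oplus> y [^] p"
proof -
  have z: "[n] \<cdot> w = \<zero>" if w: "w \<in> carrier R" and "p dvd n" for n :: nat and w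
  proof -
    obtain m where "n = p * m" using \<open>p dvd n\<close> by auto
    have "[n] \<cdot> w = ([n] \<cdot> \<one>) \<otimes> w" using w by (simp add: add_pow_ldistr)
    also have "[n] \<cdot> \<one> = [m] \<cdot> ([p] \<cdot> \<one>)" using \<open>n = p * m\<close> by (simp add: add.nat_pow_pow)
    finally show ?thesis using p w by simp
  qed
  have one: "(\<one> \<oplus> w) [^] p = \<one> \<oplus> w [^] p" if w: "w \<in> carrier R" for w
  proof -
    obtain r where r: "p = Suc r" using p prime_gt_0_nat[of p] by (metis Suc_pred)
    have "(\<one> \<oplus> w) [^] p = (\<Oplus>k\<in>{..p}. [(p choose k)] \<cdot> (w [^] k))"
      by (rule binomial_pow[OF w])
    also have "\<dots> = [(p choose p)] \<cdot> (w [^] p) \<oplus> (\<Oplus>k\<in>{..r}. [(p choose k)] \<cdot> (w [^] k))"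
      using w r by simp
    also have "(\<Oplus>k\<in>{..r}. [(p choose k)] \<cdot> (w [^] k)) = (\<Oplus>k\<in>{..r}. if k = 0 then \<one> else \<zero>)"
    proof (intro finsum_cong')
      fix k assume "k \<in> {..r}"
      then show "[(p choose k)] \<cdot> (w [^] k) = (if k = 0 then \<one> else \<zero>)"
        using w p r by (auto intro!: z dvd_choose_prime)
    qed auto
    also have "\<dots> = \<one>"
      using finsum_singleton[of 0 "{..r}" "\<lambda>_. \<one>"] by (simp add: eq_commute)
    finally show ?thesis using w by (simp add: a_comm)
  qed
  show ?thesis
  proof (cases "y = \<zero>")
    case True
    then show ?thesis using x p prime_gt_0_nat[of p] by (simp add: nat_pow_zero)
  next
    \<comment> \<open>\<open>one\<close> covers only sums of the form 1 + w, so the nonzero y is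
      divided out.\<close>
    case False
    then have u: "y \<in> Units R" using y by (simp add: field_Units)
    define w where "w = x \<otimes> inv y"
    have w: "w \<in> carrier R" "x = w \<otimes> y" using u x y by (auto simp: w_def m_assoc)
    have "x \<oplus> y = (\<one> \<oplus> w) \<otimes> y" using w y by (simp add: l_distr a_comm)
    then have "(x \<oplus> y) [^] p = (\<one> \<oplus> w) [^] p \<otimes> y [^] p" using w y by (simp add: nat_pow_distrib)
    also have "\<dots> = x [^] p \<oplus> y [^] p" unfolding one[OF w(1)] using w y by (simp add: nat_pow_distrib l_distr a_comm)
    finally show ?thesis .
  qed
qed

lemma (in field) freshmans_dream_pow:
  assumes p: "prime (p::nat)" "[p] \<cdot> \<one> = \<zero>" and x: "x \<in> carrier R" and y: "y \<in> carrier R"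
  shows "(x \<oplus> y) [^] (p ^ r) = x [^] (p ^ r) \<oplus> y [^] (p ^ r)"
proof (induction r)
  case 0
  then show ?case using x y by simp
next
  case (Suc r)
  have "(x \<oplus> y) [^] (p ^ Suc r) = ((x \<oplus> y) [^] (p ^ r)) [^] p"
    using x y by (simp add: nat_pow_pow mult.commute)
  also have "\<dots> = (x [^] (p ^ r)) [^] p \<oplus> (y [^] (p ^ r)) [^] p"
    unfolding Suc.IH using x y by (intro freshmans_dream p) auto
  finally show ?case using x y by (simp add: nat_pow_pow mult.commute)
qed

section \<open>Fixed fields of powers of Frobenius in an algebraically closed field\<close>

lemma (in algebraically_closed) exists_root_of_poly:
  assumes "P \<in> carrier (poly_ring L)" "degree P > 0"
  obtains x where "x \<in> carrier L" "eval P x = \<zero>"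
proof -
  have "roots P \<noteq> {#}" using roots_over_carrier[OF assms(1)] assms(2) unfolding splitted_def by auto
  then show ?thesis using that roots_mem_iff_is_root[OF assms(1)] unfolding is_root_def by fastforce
qed

text \<open>Coefficient lists start with the leading coefficient, so the list of n ones is 1 + X +
  ... + X^(n-1). This quotient of X^n - 1 by X - 1 takes the value n at 1, which is what separates
  its roots from 1.\<close>

lemma (in cring) eval_replicate_one:
  assumes "x \<in> carrier R"
  shows "eval (replicate n \<one>) x \<otimes> (x \<ominus> \<one>) = x [^] n \<ominus> \<one>"
proof (induction n)
  case 0
  then show ?case using assms by (simp add: minus_eq r_neg)
next
  case (Suc n)
  have c: "eval (replicate n \<one>) x \<in> carrier R"
    using assms by (intro eval_in_carrier) auto
  have "eval (replicate (Suc n) \<one>) x \<otimes> (x \<ominus> \<one>) = (x [^] n \<oplus> eval (replicate n \<one>) x) \<otimes> (x \<ominus> \<one>)"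
    using assms by simp
  also have "\<dots> = x [^] n \<otimes> (x \<ominus> \<one>) \<oplus> (x [^] n \<ominus> \<one>)"
    using c assms by (simp add: l_distr Suc.IH)
  also have "\<dots> = x [^] Suc n \<ominus> \<one>"
  proof -
    have "x [^] n \<in> carrier R" using assms by simp
    then show ?thesis unfolding nat_pow_Suc using assms by algebra
  qed
  finally show ?case .
qed

lemma (in cring) eval_replicate_one_at_one:
  "eval (replicate n \<one>) \<one> = [n] \<cdot> \<one>"
  by (induction n) (auto simp: a_comm)


lemma (in ring_hom_ring) hom_add_pow_nat:
  assumes "x \<in> carrier R"
  shows "h ([(n::nat)] \<cdot>\<^bsub>R\<^esub> x) = [n] \<cdot>\<^bsub>S\<^esub> h x"
  using assms by (induction n) auto

text \<open>By \<open>freshmans_dream_pow\<close> the map x -> x^(p^r) is additive as well as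
  multiplicative, and the fixed points of a field endomorphism form a subfield.\<close>

lemma (in field) subfield_fixed_by_power:
  assumes p: "prime (p::nat)" "[p] \<cdot> \<one> = \<zero>"
  shows "subfield {x \<in> carrier R. x [^] (p ^ r) = x} R"
proof (rule subfieldI'[OF subringI])
  let ?K = "{x \<in> carrier R. x [^] (p ^ r) = x}"
  have pos: "p ^ r \<noteq> 0" using p by simp
  show "?K \<subseteq> carrier R" "\<one> \<in> ?K" by auto
  show "x \<otimes> y \<in> ?K" if "x \<in> ?K" "y \<in> ?K" for x y
    using that by (auto simp: nat_pow_distrib)
  show add: "x \<oplus> y \<in> ?K" if "x \<in> ?K" "y \<in> ?K" for x y
    using that freshmans_dream_pow[OF p, of x y r] by auto
  show "\<ominus> x \<in> ?K" if "x \<in> ?K" for x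
  proof -
    have x: "x \<in> carrier R" "x [^] (p ^ r) = x" using that by auto
    \<comment> \<open>Additivity applied to x + (- x) = 0 needs no distinction between odd p and p =
      2.\<close>
    have "x \<oplus> (\<ominus> x) [^] (p ^ r) = (x \<oplus> \<ominus> x) [^] (p ^ r)"
      using freshmans_dream_pow[OF p, of x "\<ominus> x" r] x by simp
    also have "\<dots> = \<zero>" using x pos by (simp add: r_neg nat_pow_zero)
    finally have "\<ominus> x = (\<ominus> x) [^] (p ^ r)"
      using x by (metis a_inv_closed nat_pow_closed minus_equality a_comm)
    then show ?thesis using x by auto
  qed
  show "inv x \<in> ?K" if "x \<in> ?K - {\<zero>}" for x
  proof -
    have x: "x \<in> carrier R" "x [^] (p ^ r) = x" "x \<in> Units R" using that field_Units by auto
    have "(inv x) [^] (p ^ r) \<otimes> x = (inv x) [^] (p ^ r) \<otimes> x [^] (p ^ r)" using x by simp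
    also have "\<dots> = (inv x \<otimes> x) [^] (p ^ r)" using x by (intro nat_pow_distrib[symmetric]) auto
    also have "\<dots> = \<one>" using x by simp
    finally have "inv x = (inv x) [^] (p ^ r)"
      using x by (metis Units_inv_closed inv_char m_comm nat_pow_closed)
    then show ?thesis using x by auto
  qed
qed

lemma (in field) card_fixed_by_power_le:
  assumes "q \<ge> (2::nat)"
  shows "finite {x \<in> carrier R. x [^] q = x}" "card {x \<in> carrier R. x [^] q = x} \<le> q"
proof -
  let ?K = "{x \<in> carrier R. x [^] q = x}"
  \<comment> \<open>The coefficient list of X^q - X; q being at least 2 gives it the right length q
    + 1.\<close>
  define P where "P = \<one> # replicate (q - 2) \<zero> @ [\<ominus> \<one>, \<zero>]"
  have P: "P \<in> carrier (poly_ring R)"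
    unfolding univ_poly_carrier[symmetric] polynomial_def P_def by auto
  have "is_root P x" if "x \<in> ?K" for x
  proof -
    have x: "x \<in> carrier R" "x [^] q = x" using that by auto
    have "eval P x = x [^] Suc (Suc (q - 2)) \<oplus> eval (replicate (q - 2) \<zero> @ [\<ominus> \<one>, \<zero>]) x"
      using x by (simp add: P_def)
    also have "Suc (Suc (q - 2)) = q" using assms by simp
    also have "eval (replicate (q - 2) \<zero> @ [\<ominus> \<one>, \<zero>]) x = \<ominus> x"
      using x by (subst eval_replicate) (auto simp: l_minus)
    finally show ?thesis using x by (simp add: is_root_def P_def r_neg)
  qed
  then have sub: "?K \<subseteq> set_mset (roots P)" using roots_mem_iff_is_root[OF P] by auto
  then show "finite ?K" by (rule finite_subset) simp
  have "card ?K \<le> card (set_mset (roots P))" using sub by (intro card_mono) auto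
  also have "\<dots> \<le> size (roots P)"
    by (subst card_eq_sum, subst size_multiset_overloaded_eq, rule sum_mono) (simp add: Suc_le_eq)
  also have "\<dots> \<le> degree P" by (rule size_roots_le_degree[OF P])
  also have "degree P = q" using assms by (simp add: P_def)
  finally show "card ?K \<le> q" .
qed

text \<open>A root y of 1 + X + ... + X^(l-1) is an l-th root of unity, and it differs from 1
  because that polynomial has the value l at 1, nonzero by hypothesis. An l^e-th root x of y then
  has order exactly l^(e+1).\<close>

lemma (in algebraically_closed) exists_primitive_root_of_unity:
  assumes l: "prime (l::nat)" "[l] \<cdot> \<one> \<noteq> \<zero>"
  obtains x where "x \<in> carrier L" "x [^] (l ^ Suc e) = \<one>" "x [^] (l ^ e) \<noteq> \<one>"
proof -
  have l1: "l > 1" using l prime_gt_1_nat by auto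
  have P: "replicate l \<one> \<in> carrier (poly_ring L)"
    unfolding univ_poly_carrier[symmetric] polynomial_def using l1 by auto
  obtain y where y: "y \<in> carrier L" "eval (replicate l \<one>) y = \<zero>"
    using exists_root_of_poly[OF P] l1 by auto
  have "y \<noteq> \<one>" using y l eval_replicate_one_at_one[of l] by metis
  have "y [^] l \<ominus> \<one> = \<zero>" using eval_replicate_one[of y l] y by simp
  then have yl: "y [^] l = \<one>" using y by simp
  define N where "N = l ^ e"
  have N: "N > 0" using l1 by (simp add: N_def)
  define Q where "Q = \<one> # replicate (N - 1) \<zero> @ [\<ominus> y]"
  have Q: "Q \<in> carrier (poly_ring L)"
    unfolding univ_poly_carrier[symmetric] polynomial_def Q_def using y by auto
  obtain x where x: "x \<in> carrier L" "eval Q x = \<zero>"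
    using exists_root_of_poly[OF Q] N by (auto simp: Q_def)
  have "eval Q x = x [^] N \<oplus> eval (replicate (N - 1) \<zero> @ [\<ominus> y]) x"
    using x N by (simp add: Q_def)
  also have "eval (replicate (N - 1) \<zero> @ [\<ominus> y]) x = \<ominus> y"
    using x y by (subst eval_replicate) auto
  finally have "x [^] N \<ominus> y = \<zero>" using x by (simp add: minus_eq)
  then have xN: "x [^] N = y" using x y by simp
  have "x [^] (l ^ Suc e) = (x [^] N) [^] l" using x by (simp add: nat_pow_pow N_def mult.commute)
  then have "x [^] (l ^ Suc e) = \<one>" using xN yl by simp
  then show ?thesis using that x xN \<open>y \<noteq> \<one>\<close> by (simp add: N_def)
qed

text \<open>Counting the roots of X^q - X gives at most q elements. The lower bound avoids
  separability: if l^(e+1) divides q - 1, a root of unity of that order is fixed by the q-th power,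
  so l^(e+1) divides the order of the multiplicative group of the fixed field. Taken over all primes
  l, this makes q - 1 a divisor of that order.\<close>

lemma (in algebraically_closed) card_fixed_by_power:
  assumes p: "prime (p::nat)" "[p] \<cdot> \<one> = \<zero>" and "r > 0"
  shows "card {x \<in> carrier L. x [^] (p ^ r) = x} = p ^ r"
proof -
  define q where "q = p ^ r"
  have "p \<ge> 2" using p prime_ge_2_nat by auto
  then have q2: "q \<ge> 2" using \<open>r > 0\<close> unfolding q_def
    by (metis One_nat_def Suc_leI le_trans power_increasing power_one_right Suc_1 Suc_le_lessD less_imp_le)
  define K where "K = {x \<in> carrier L. x [^] q = x}"
  have sf: "subfield K L" unfolding K_def q_def by (rule subfield_fixed_by_power[OF p])
  interpret F: field "L\<lparr>carrier := K\<rparr>" by (rule subfield_iff(2)[OF sf])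
  have fin: "finite K" and le: "card K \<le> q"
    using card_fixed_by_power_le[OF q2] by (auto simp: K_def)
  interpret G: group "Multiplicative_Group.mult_of (L\<lparr>carrier := K\<rparr>)" by (rule F.field_mult_group)
  have ordG: "order (Multiplicative_Group.mult_of (L\<lparr>carrier := K\<rparr>)) = card K - 1"
    using F.order_mult_of fin by (simp add: order_def)
  have sub: "{\<zero>, \<one>} \<subseteq> K" using q2 by (auto simp: K_def nat_pow_zero)
  have "card {\<zero>, \<one>} \<le> card K" using sub fin by (intro card_mono) auto
  then have card2: "card K \<ge> 2" by simp
  have "q - 1 dvd card K - 1"
  proof (rule multiplicity_le_imp_dvd)
    show "q - 1 \<noteq> 0" using q2 by simp
    fix l :: nat assume l: "prime l"
    show "multiplicity l (q - 1) \<le> multiplicity l (card K - 1)"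
    proof (cases "multiplicity l (q - 1)")
      case (Suc e)
      have dv: "l ^ Suc e dvd q - 1" using multiplicity_dvd[of l "q - 1"] Suc by simp
      \<comment> \<open>A prime l dividing q - 1 differs from p, and two distinct primes cannot both
        annihilate 1.\<close>
      have "[l] \<cdot> \<one> \<noteq> \<zero>"
      proof
        assume "[l] \<cdot> \<one> = \<zero>"
        have "l \<noteq> p"
        proof
          assume "l = p"
          then have "p dvd q - 1" using dv by (meson dvd_trans dvd_triv_left power_Suc dvd_power_same dvd_power zero_less_Suc)
          moreover have "p dvd q" unfolding q_def using \<open>r > 0\<close> by simp
          ultimately have "p dvd 1" using q2 by (metis dvd_diffD1 le_trans one_le_numeral)
          then show False using p by auto
        qed
        then have "coprime l p" using l p by (simp add: primes_coprime)
        then show False using add_pow_coprime_imp_trivial[of l p] \<open>[l] \<cdot> \<one> = \<zero>\<close> p by simp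
      qed
      then obtain x where x: "x \<in> carrier L" "x [^] (l ^ Suc e) = \<one>" "x [^] (l ^ e) \<noteq> \<one>"
        using exists_primitive_root_of_unity[OF l] by blast
      obtain d where d: "q - 1 = l ^ Suc e * d" using dv by auto
      have "x [^] (q - 1) = \<one>" unfolding d using x by (simp flip: nat_pow_pow del: power_Suc)
      then have "x [^] Suc (q - 1) = x" using x by simp
      then have "x [^] q = x" using q2 by (simp del: nat_pow_Suc)
      moreover have "x \<noteq> \<zero>" using x(2) l by (auto simp: nat_pow_zero simp del: power_Suc)
      ultimately have xG: "x \<in> carrier (Multiplicative_Group.mult_of (L\<lparr>carrier := K\<rparr>))" using x by (simp add: K_def)
      have pw: "x [^]\<^bsub>Multiplicative_Group.mult_of (L\<lparr>carrier := K\<rparr>)\<^esub> (j::nat) = x [^] j" for j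
        by (simp add: Multiplicative_Group.nat_pow_mult_of nat_pow_consistent[symmetric])
      have "G.ord x dvd l ^ Suc e" "\<not> G.ord x dvd l ^ e"
        using G.pow_eq_id[OF xG] pw x by auto
      then have "G.ord x = l ^ Suc e"
        using divides_primepow_nat[OF l] le_Suc_eq by (metis)
      then have "l ^ Suc e dvd card K - 1"
        using G.ord_dvd_group_order[OF xG] ordG by simp
      then show ?thesis using Suc card2 l by (intro multiplicity_geI) auto
    qed simp
  qed
  then have "q - 1 \<le> card K - 1" using card2 by (intro dvd_imp_le) auto
  then show ?thesis using le card2 by (simp add: K_def q_def)
qed

text \<open>The existential half of \<open>theorem1p2\<close> is not given a field, so one is built
  on a concrete type: the fixed points of x -> x^q in the algebraic closure of the integers modulo
  p. The type is that of the indexed polynomials from which this closure is made.\<close>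

theorem exists_finite_field_of_primepow_order:
  assumes "primepow q"
  obtains F :: "((int list \<times> nat) multiset \<Rightarrow> int) ring" where "field F" "card (carrier F) = q"
proof -
  obtain p r where pr: "prime p" "r > 0" "q = p ^ r" using assms unfolding primepow_def by auto
  define R where "R = residue_ring (int p)"
  interpret R: residues_prime p R by unfold_locales (use pr R_def in auto)
  obtain L :: "((int list \<times> nat) multiset \<Rightarrow> int) ring" where
    L: "algebraic_closure L (R.indexed_const ` carrier R)" "R.indexed_const \<in> Ring.ring_hom R L"
    using R.exists_closure by blast
  interpret L: algebraic_closure L "R.indexed_const ` carrier R" by (rule L)
  interpret h: ring_hom_ring R L R.indexed_const
    using L(2) by (intro ring_hom_ringI2) (auto intro: R.ring_axioms L.ring_axioms)
  have "card (carrier R) = p" by (simp add: R_def residue_ring_def)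
  then have "[p] \<cdot>\<^bsub>R\<^esub> \<one>\<^bsub>R\<^esub> = \<zero>\<^bsub>R\<^esub>" using R.add_pow_card_carrier[of "\<one>\<^bsub>R\<^esub>"] by simp
  then have p0: "[p] \<cdot>\<^bsub>L\<^esub> \<one>\<^bsub>L\<^esub> = \<zero>\<^bsub>L\<^esub>" using h.hom_add_pow_nat[of "\<one>\<^bsub>R\<^esub>" p] by simp
  let ?K = "{x \<in> carrier L. x [^]\<^bsub>L\<^esub> (p ^ r) = x}"
  have "field (L\<lparr>carrier := ?K\<rparr>)"
    by (rule L.subfield_iff(2)[OF L.subfield_fixed_by_power[OF pr(1) p0]])
  moreover have "card (carrier (L\<lparr>carrier := ?K\<rparr>)) = q"
    using L.card_fixed_by_power[OF pr(1) p0 pr(2)] pr by simp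
  ultimately show ?thesis using that by blast
qed

section \<open>Arithmetic\<close>

lemma lucas_binomial_cong:
  fixes p a b c d :: nat
  assumes p: "prime p" and "b < p" "d < p"
  shows "[(p * a + b) choose (p * c + d) = (a choose c) * (b choose d)] (mod p)"
proof (induction a arbitrary: c)
  case 0
  have "(b choose (p * c + d)) = (0 choose c) * (b choose d)"
  proof (cases c)
    case (Suc c')
    then have "b < p * c + d" using \<open>b < p\<close> by simp
    then show ?thesis using Suc by (simp add: binomial_eq_0)
  qed simp
  then show ?case by simp
next
  case (Suc a)
  define k where "k = p * c + d"
  have p0: "p > 0" using p prime_gt_0_nat by auto
  let ?A = "(p * a + b) choose k" and ?B = "(p * a + b) choose (k - p)"
  \<comment> \<open>Adding p to the upper index is Vandermonde's convolution with row p of Pascal's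
    triangle, of which only the entries 0 and p survive modulo p.\<close>
  have e1: "((p * Suc a + b) choose k) = (\<Sum>i\<le>k. (p choose i) * ((p * a + b) choose (k - i)))"
    by (simp add: vandermonde ac_simps)
  have c1: "[(\<Sum>i\<le>k. (p choose i) * ((p * a + b) choose (k - i))) = (\<Sum>i\<le>k. (if i = 0 then ?A else 0) + (if i = p then ?B else 0))] (mod p)"
  proof (rule cong_sum)
    fix i
    consider "i = 0" | "i = p" | "0 < i" "i < p" | "p < i" by linarith
    then show "[(p choose i) * ((p * a + b) choose (k - i)) =
        (if i = 0 then ?A else 0) + (if i = p then ?B else 0)] (mod p)"
    proof cases
      case 3
      then have "p dvd (p choose i)" using p by (intro dvd_choose_prime) auto
      then show ?thesis using 3 by (auto simp: cong_0_iff)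
    qed (use p0 in \<open>auto simp: binomial_eq_0\<close>)
  qed
  \<comment> \<open>For c = 0 one has k = d < p, so i = p lies outside the range and the truncated
    \<open>k - p\<close> in \<open>?B\<close> must not be counted.\<close>
  have e2: "(\<Sum>i\<le>k. (if i = 0 then ?A else 0) + (if i = p then ?B else 0)) = ?A + (if c = 0 then 0 else ?B)"
  proof -
    have "p \<le> k \<longleftrightarrow> c \<noteq> 0" using \<open>d < p\<close> by (cases c) (auto simp: k_def)
    then show ?thesis by (simp add: sum.distrib)
  qed
  have c2: "[?A + (if c = 0 then 0 else ?B) = (a choose c) * (b choose d) + (if c = 0 then 0 else (a choose (c - 1)) * (b choose d))] (mod p)"
  proof (rule cong_add)
    show "[?A = (a choose c) * (b choose d)] (mod p)" unfolding k_def by (rule Suc.IH)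
    show "[(if c = 0 then 0 else ?B) = (if c = 0 then 0 else (a choose (c - 1)) * (b choose d))] (mod p)"
    proof (cases c)
      case (Suc c')
      then have "k - p = p * c' + d" by (simp add: k_def)
      then show ?thesis using Suc.IH[of c'] Suc by simp
    qed simp
  qed
  have e3: "(a choose c) * (b choose d) + (if c = 0 then 0 else (a choose (c - 1)) * (b choose d)) =
      (Suc a choose c) * (b choose d)"
    by (cases c) (simp_all add: algebra_simps)
  have "[(p * Suc a + b) choose k = (Suc a choose c) * (b choose d)] (mod p)"
    using cong_trans[OF c1[unfolded e2] c2] by (simp only: e1 e3)
  then show ?case by (simp only: k_def)
qed

lemma prime_not_dvd_binomial:
  fixes p n k :: nat
  assumes p: "prime p" and "n < p" "k \<le> n"
  shows "\<not> p dvd (n choose k)"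
proof
  assume "p dvd (n choose k)"
  then have "p dvd fact k * fact (n - k) * (n choose k)" by (rule dvd_mult)
  then have "p dvd fact n" unfolding binomial_fact_lemma[OF \<open>k \<le> n\<close>] by simp
  then show False using prime_dvd_fact_iff[OF p] \<open>n < p\<close> by simp
qed

text \<open>The condition modulo 8 forces r to be odd and p = 8 u + 3. In base p all digits of (q -
  1) / 2 are then 4 u + 1, while those of (q - 3) / 8 alternate between u and 3 u + 1, with u at
  both ends; none exceeds 4 u + 1, so no factor of Lucas' product is divisible by p.\<close>

lemma prime_not_dvd_binomial_half_eighth:
  fixes p q r :: nat
  assumes p: "prime p" and q: "q = p ^ r" "q mod 8 = 3"
  shows "\<not> p dvd ((q - 1) div 2 choose (q - 3) div 8)"
proof -
  have "odd q" using q(2) by presburger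
  then have "odd p \<or> r = 0" using q by auto
  moreover have "r \<noteq> 0" using q by (intro notI) auto
  ultimately have "odd p" by simp
  have sq: "p\<^sup>2 mod 8 = 1"
  proof -
    have "p mod 8 = 1 \<or> p mod 8 = 3 \<or> p mod 8 = 5 \<or> p mod 8 = 7" using \<open>odd p\<close> by presburger
    moreover have "p\<^sup>2 mod 8 = (p mod 8)\<^sup>2 mod 8" by (rule power_mod[symmetric])
    ultimately show ?thesis by (elim disjE) simp_all
  qed
  have even_pow: "p ^ (2 * k) mod 8 = 1" for k
    using power_mod[of "p\<^sup>2" 8 k] sq by (simp add: power_mult)
  have "odd r"
  proof
    assume "even r"
    then obtain k where "r = 2 * k" by auto
    then show False using even_pow[of k] q by simp
  qed
  then obtain k where k: "r = 2 * k + 1" by (auto elim: oddE)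
  have "q mod 8 = (p ^ (2 * k) mod 8) * (p mod 8) mod 8" using q k by (simp add: mod_mult_eq mult.commute)
  then have "p mod 8 = 3" using even_pow[of k] q by simp
  then have "p = 8 * (p div 8) + 3" by presburger
  then obtain u where u: "p = 8 * u + 3" by blast
  have main: "\<exists>w. p ^ (2 * j + 1) = 8 * w + 3 \<and> \<not> p dvd ((4 * w + 1) choose w)" for j
  proof (induction j)
    case 0
    have "\<not> p dvd ((4 * u + 1) choose u)" by (rule prime_not_dvd_binomial[OF p]) (simp_all add: u)
    moreover have "p ^ (2 * 0 + 1) = 8 * u + 3" using u by (simp only: mult_0_right add_0 power_one_right)
    ultimately show ?case by blast
  next
    case (Suc j)
    then obtain w where w: "p ^ (2 * j + 1) = 8 * w + 3" "\<not> p dvd ((4 * w + 1) choose w)" by blast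
    \<comment> \<open>Passing from p^(2j+1) to p^(2j+3) appends the two lowest digits 3 u + 1 and
      u.\<close>
    define w' where "w' = p * (p * w + (3 * u + 1)) + u"
    have N: "4 * w' + 1 = p * (p * (4 * w + 1) + (4 * u + 1)) + (4 * u + 1)"
      unfolding w'_def u by (simp add: algebra_simps)
    have "p ^ (2 * Suc j + 1) = p * p * p ^ (2 * j + 1)" by simp
    also have "\<dots> = p * p * (8 * w + 3)" by (simp only: w(1))
    also have "\<dots> = 8 * w' + 3" unfolding w'_def u by (simp add: algebra_simps)
    finally have 1: "p ^ (2 * Suc j + 1) = 8 * w' + 3" .
    have "[(4 * w' + 1) choose w' =
        ((p * (4 * w + 1) + (4 * u + 1)) choose (p * w + (3 * u + 1))) * ((4 * u + 1) choose u)] (mod p)"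
      unfolding N unfolding w'_def by (rule lucas_binomial_cong[OF p]) (simp_all add: u)
    also have "[((p * (4 * w + 1) + (4 * u + 1)) choose (p * w + (3 * u + 1))) * ((4 * u + 1) choose u) =
        (((4 * w + 1) choose w) * ((4 * u + 1) choose (3 * u + 1))) * ((4 * u + 1) choose u)] (mod p)"
      by (rule cong_mult[OF lucas_binomial_cong[OF p] cong_refl]) (simp_all add: u)
    finally have "p dvd ((4 * w' + 1) choose w') \<longleftrightarrow>
        p dvd (((4 * w + 1) choose w) * ((4 * u + 1) choose (3 * u + 1))) * ((4 * u + 1) choose u)"
      by (rule cong_dvd_iff)
    moreover have "\<not> p dvd ((4 * u + 1) choose (3 * u + 1))" "\<not> p dvd ((4 * u + 1) choose u)"
      by (rule prime_not_dvd_binomial[OF p]; simp add: u)+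
    ultimately have "\<not> p dvd ((4 * w' + 1) choose w')"
      using w(2) prime_dvd_mult_iff[OF p] by blast
    with 1 show ?case by blast
  qed
  obtain w where w: "q = 8 * w + 3" "\<not> p dvd ((4 * w + 1) choose w)"
    using main[of k] unfolding q(1) k by blast
  have "(q - 1) div 2 = 4 * w + 1" "(q - 3) div 8 = w" using w(1) by auto
  then show ?thesis using w(2) by simp
qed

text \<open>Uniqueness of primitive representations by the norm form of Z[sqrt(-2)], by comparison
  with the given one, c^2 + 2. Since b^2 - a^2 c^2 = q (1 - a^2), q divides (b - a c) (b + a c); as
  p is odd and does not divide b, all of q divides one of the factors, and a' is a or - a
  accordingly.\<close>

lemma square_plus_two_squares_unique:
  fixes a b c :: int and p q r :: nat
  assumes p: "prime p" "odd p" and q: "q = p ^ r" and c: "int q = c\<^sup>2 + 2"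
    and ab: "b\<^sup>2 + 2 * a\<^sup>2 = int q" and nd: "\<not> (int p dvd a \<and> int p dvd b)"
  shows "a\<^sup>2 = 1 \<and> b\<^sup>2 = c\<^sup>2"
proof -
  have pr: "prime (int p)" using p by simp
  have "r \<noteq> 0"
  proof
    assume "r = 0"
    then have "c\<^sup>2 = -1" using c q by simp
    then show False using zero_le_power2[of c] by linarith
  qed
  then have pq: "int p dvd int q" using q by simp
  have np2: "\<not> int p dvd 2"
  proof
    assume "int p dvd 2"
    then have "p \<le> 2" using zdvd_imp_le[of "int p" 2] by simp
    moreover have "p \<ge> 2" using p prime_ge_2_nat by blast
    ultimately show False using p(2) by simp
  qed
  have nb: "\<not> int p dvd b"
  proof
    assume b: "int p dvd b"
    then have "int p dvd int q - b\<^sup>2" using pq by (simp add: power2_eq_square)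
    then have "int p dvd 2 * a\<^sup>2" using ab by (metis add_diff_cancel_left')
    then have "int p dvd a" using pr np2 by (auto simp: prime_dvd_mult_iff prime_dvd_power_iff)
    with b nd show False by simp
  qed
  have b2: "b\<^sup>2 = int q - 2 * a\<^sup>2" and c2: "c\<^sup>2 = int q - 2" using ab c by simp_all
  have "(b - a * c) * (b + a * c) = b\<^sup>2 - a\<^sup>2 * c\<^sup>2"
    by (simp add: power2_eq_square algebra_simps)
  also have "\<dots> = int q * (1 - a\<^sup>2)" unfolding b2 c2 by (simp add: algebra_simps)
  finally have "(b - a * c) * (b + a * c) = int q * (1 - a\<^sup>2)" .
  then have dv: "int q dvd (b - a * c) * (b + a * c)" by simp
  have "\<exists>a'. a'\<^sup>2 = a\<^sup>2 \<and> int q dvd b - a' * c"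
  proof (cases "int p dvd b - a * c")
    case True
    have "\<not> int p dvd b + a * c"
    proof
      assume "int p dvd b + a * c"
      then have "int p dvd (b - a * c) + (b + a * c)" by (rule dvd_add[OF True])
      then have "int p dvd 2 * b" by simp
      then show False using nb np2 pr by (auto simp: prime_dvd_mult_iff)
    qed
    then have "coprime (int q) (b + a * c)" using prime_imp_coprime[OF pr] q by simp
    then have "int q dvd b - a * c" using dv by (simp add: coprime_dvd_mult_left_iff)
    then show ?thesis by auto
  next
    case False
    then have "coprime (int q) (b - a * c)" using prime_imp_coprime[OF pr] q by simp
    then have "int q dvd b - (- a) * c" using dv by (simp add: coprime_dvd_mult_right_iff)
    then show ?thesis by (intro exI[of _ "- a"]) auto
  qed
  then obtain a' where a': "a'\<^sup>2 = a\<^sup>2" "int q dvd b - a' * c" by blast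
  have q0: "int q > 0" using c zero_le_power2[of c] by linarith
  \<comment> \<open>The norm of (b + a' sqrt(-2)) (c - sqrt(-2)). If b - a' c were a nonzero
    multiple of q, this norm would be at least 2 q^2.\<close>
  have "(b * c + 2 * a')\<^sup>2 + 2 * (b - a' * c)\<^sup>2 = (b\<^sup>2 + 2 * a'\<^sup>2) * (c\<^sup>2 + 2)"
    by (simp add: power2_eq_square algebra_simps)
  also have "\<dots> = (int q)\<^sup>2" unfolding a'(1) ab c[symmetric] by (simp add: power2_eq_square)
  finally have "(b * c + 2 * a')\<^sup>2 + 2 * (b - a' * c)\<^sup>2 = (int q)\<^sup>2" .
  then have "2 * (b - a' * c)\<^sup>2 \<le> (int q)\<^sup>2" using zero_le_power2[of "b * c + 2 * a'"] by linarith
  moreover have "(int q)\<^sup>2 > 0" using q0 by simp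
  ultimately have "(b - a' * c)\<^sup>2 < (int q)\<^sup>2" using zero_le_power2[of "b - a' * c"] by linarith
  then have "\<bar>b - a' * c\<bar> < \<bar>int q\<bar>" using abs_le_square_iff[of "int q" "b - a' * c"] by linarith
  then have "b - a' * c = 0" using a'(2) dvd_imp_le_int[of "b - a' * c" "int q"] by (cases "b - a' * c = 0") auto
  then have "b\<^sup>2 = a\<^sup>2 * c\<^sup>2" using a'(1) by (simp add: power_mult_distrib)
  then have "int q * a\<^sup>2 = int q * 1" using b2 c2 by (simp add: algebra_simps)
  then have "a\<^sup>2 = 1" using q0 by simp
  then show ?thesis using ab c by simp
qed

section \<open>Evaluation of the excess bound\<close>

lemma bound_k_eqI:
  assumes "even k" "0 \<le> k" "k\<^sup>2 \<le> int n" "int n < (k + 2)\<^sup>2"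
  shows "bound_k n = k"
  unfolding bound_k_def
proof (rule the1_equality[OF bound_k_ex1], intro conjI)
  have "real_of_int (k\<^sup>2) \<le> real n" "real n < real_of_int ((k + 2)\<^sup>2)"
    using assms(3,4) by linarith+
  then show "real_of_int k \<le> sqrt (real n)" "sqrt (real n) < real_of_int k + 2"
    using assms(2) by (auto intro!: real_le_rsqrt real_less_lsqrt)
qed (use assms in auto)

text \<open>The case m = 0. Here n = (2 m + 2)^2 is itself an even square, so k is 2 m + 2 rather
  than 2 m, and the formula of \<open>excess_bound_eq\<close> would give 4.\<close>

lemma excess_bound_order_4: "excess_bound 4 = 8"
proof -
  have "bound_k 4 = 2" by (rule bound_k_eqI) auto
  then have "bound_t 4 = 2" by (simp add: bound_t_def)
  then show ?thesis by (simp add: excess_bound_def bound_s_def)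
qed

text \<open>n lies strictly between the squares of 2 m and 2 m + 2 and is nearer to the second one,
  so t = k - 2. The quotient defining s is exactly the integer n / 4, hence the floor loses nothing
  and the bound is n (2 m + 2) - n.\<close>

lemma excess_bound_eq:
  fixes m :: int
  assumes "m \<ge> 1" and n: "int n = 4 * m\<^sup>2 + 4 * m + 4"
  shows "excess_bound n = int n * (2 * m + 1)"
proof -
  have d1: "int n - (2 * m)\<^sup>2 = 4 * m + 4" and d2: "int n - (2 * m + 2)\<^sup>2 = - 4 * m"
    unfolding n by (simp_all add: power2_eq_square algebra_simps)
  have k: "bound_k n = 2 * m"
    using assms(1) d1 d2 by (intro bound_k_eqI) auto
  have t: "bound_t n = 2 * m - 2"
    using assms(1) unfolding bound_t_def k Let_def d1 d2 by simp
  define M where "M = real_of_int m"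
  have M: "M \<ge> 1" using assms(1) by (simp add: M_def)
  have rn: "real n = 4 * (M * M + M + 1)"
    using arg_cong[OF n, of real_of_int] by (simp add: M_def power2_eq_square algebra_simps)
  have t': "real_of_int (2 * m - 2) = 2 * M - 2" by (simp add: M_def)
  have "real n * ((real_of_int (2 * m - 2) + 4)\<^sup>2 - real n) / (8 * real_of_int (2 * m - 2) + 16) =
      4 * (M * M + M + 1) * (4 * M) / (16 * M)"
    unfolding rn t' by (simp add: power2_eq_square algebra_simps)
  also have "\<dots> = M * M + M + 1" using M by simp
  also have "\<dots> = real_of_int (m\<^sup>2 + m + 1)" by (simp add: M_def power2_eq_square)
  finally have "real n * ((real_of_int (2 * m - 2) + 4)\<^sup>2 - real n) / (8 * real_of_int (2 * m - 2) + 16) =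
      real_of_int (m\<^sup>2 + m + 1)" .
  then have "bound_s n = m\<^sup>2 + m + 1" unfolding bound_s_def t Let_def by (metis floor_of_int)
  then show ?thesis unfolding excess_bound_def t n by (simp add: algebra_simps)
qed

section \<open>Antiperiodic sequences and skew conference matrices\<close>

lemma periodic_mod:
  fixes F :: "int \<Rightarrow> 'a"
  assumes "\<And>i. F (i + P) = F i"
  shows "F (i mod P) = F i"
proof -
  have "F (i + P * z) = F i" for i z
  proof (induction z rule: int_induct[where k = 0])
    case (step1 z)
    then show ?case using assms[of "i + P * z"] by (simp add: algebra_simps)
  next
    case (step2 z)
    then show ?case using assms[of "i + P * (z - 1)"] by (simp add: algebra_simps)
  qed simp
  from this[of "i mod P" "i div P"] show ?thesis by simp
qed

lemma sum_periodic_complete_residues: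
  fixes F :: "int \<Rightarrow> int" and P :: nat
  assumes per: "\<And>i. F (i + int P) = F i" and inj: "inj_on (\<lambda>a. k a mod int P) A"
    and card: "card A = P" and P: "P > 0"
  shows "(\<Sum>a\<in>A. F (k a)) = (\<Sum>j<P. F (int j))"
proof -
  define g where "g a = nat (k a mod int P)" for a
  have g: "int (g a) = k a mod int P" for a using P by (simp add: g_def)
  have injg: "inj_on g A"
    by (rule inj_onI, rule inj_onD[OF inj]) (auto simp flip: g)
  have "g a < P" for a using g[of a] P by (metis of_nat_0_less_iff of_nat_less_iff pos_mod_bound)
  then have "g ` A = {..<P}"
    using card card_image[OF injg] by (intro card_subset_eq) auto
  then have "bij_betw g A {..<P}" using injg by (simp add: bij_betw_def)
  from sum.reindex_bij_betw[OF this, of "\<lambda>j. F (int j)"]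
  show ?thesis by (simp add: g periodic_mod[of F, OF per])
qed

lemma sum_lessThan_4_times:
  fixes G :: "nat \<Rightarrow> int"
  shows "(\<Sum>j<4 * t. G j) = (\<Sum>j<t. G (4 * j) + G (4 * j + 1) + G (4 * j + 2) + G (4 * j + 3))"
  by (induction t) (simp_all add: eval_nat_numeral add.assoc)

text \<open>What is needed of the sequence \<eta>(Im g^i), with 4 t = q + 1. The scalar g^(q+1) is a
  nonsquare, whence the change of sign; conjugation is the q-th power and negates the imaginary
  part, whence the reflection.\<close>

locale reflective_antiperiodic =
  fixes \<phi> :: "int \<Rightarrow> int" and t :: nat
  assumes odd_t: "odd t"
    and antiperiodic: "\<phi> (i + 4 * int t) = - \<phi> i"
    and reflect: "\<phi> (- i) = - parity_sign i * \<phi> i"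
begin

lemma t_pos: "t > 0" using odd_t by (rule odd_pos)

text \<open>\<open>class_sum 1\<close> and \<open>class_sum 2\<close> are the integers A and B. As t
  is odd, the alternating sign makes the summand periodic in j with period t, so any complete system
  of residues modulo t may serve as range of j.\<close>

definition class_sum :: "int \<Rightarrow> int" where
  "class_sum r = (\<Sum>j<t. parity_sign (int j) * \<phi> (4 * int j + r))"

lemma class_sum_reindex:
  assumes "inj_on (\<lambda>j. k j mod int t) {..<t}"
  shows "(\<Sum>j<t. parity_sign (k j) * \<phi> (4 * k j + r)) = class_sum r"
proof -
  have "parity_sign (i + int t) * \<phi> (4 * (i + int t) + r) = parity_sign i * \<phi> (4 * i + r)" for i
    using antiperiodic[of "4 * i + r"] odd_t by (auto simp: parity_sign_def algebra_simps)
  then show ?thesis unfolding class_sum_def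
    using assms t_pos by (intro sum_periodic_complete_residues[where F = "\<lambda>i. parity_sign i * \<phi> (4 * i + r)"]) auto
qed

lemma inj_on_uminus_mod: "inj_on (\<lambda>j. (c - int j) mod int t) {..<t}"
proof (rule inj_onI)
  fix x y assume xy: "x \<in> {..<t}" "y \<in> {..<t}" and "(c - int x) mod int t = (c - int y) mod int t"
  then have "int t dvd (c - int x) - (c - int y)" by (simp only: mod_eq_dvd_iff)
  then have "[int x = int y] (mod int t)" by (simp add: cong_iff_dvd_diff dvd_diff_commute)
  then show "x = y" using xy by (simp add: cong_def)
qed

lemma class_sum_0: "class_sum 0 = 0"
proof -
  have "class_sum 0 = (\<Sum>j<t. parity_sign (0 - int j) * \<phi> (4 * (0 - int j) + 0))"
    by (rule class_sum_reindex[OF inj_on_uminus_mod, symmetric])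
  also have "\<dots> = (\<Sum>j<t. - (parity_sign (int j) * \<phi> (4 * int j + 0)))"
    using reflect[of "4 * int j" for j] by (intro sum.cong) (auto simp: parity_sign_def)
  also have "\<dots> = - class_sum 0" unfolding class_sum_def by (rule sum_negf)
  finally show ?thesis by simp
qed

text \<open>The substitution j -> - 1 - j exchanges the classes of 1 and 3 modulo 4. It also
  preserves the class of 2, but there the two signs cancel, so \<open>class_sum 2\<close> remains
  free.\<close>

lemma class_sum_3: "class_sum 3 = - class_sum 1"
proof -
  have "class_sum 1 = (\<Sum>j<t. parity_sign (- 1 - int j) * \<phi> (4 * (- 1 - int j) + 1))"
    by (rule class_sum_reindex[OF inj_on_uminus_mod, symmetric])
  also have "\<dots> = (\<Sum>j<t. - (parity_sign (int j) * \<phi> (4 * int j + 3)))"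
  proof (intro sum.cong refl)
    fix j
    have "4 * (- 1 - int j) + 1 = - (4 * int j + 3)" by simp
    then have "\<phi> (4 * (- 1 - int j) + 1) = - parity_sign (4 * int j + 3) * \<phi> (4 * int j + 3)"
      by (simp only: reflect)
    then show "parity_sign (- 1 - int j) * \<phi> (4 * (- 1 - int j) + 1) =
        - (parity_sign (int j) * \<phi> (4 * int j + 3))" by (simp add: parity_sign_def)
  qed
  also have "\<dots> = - class_sum 3" unfolding class_sum_def by (rule sum_negf)
  finally show ?thesis by simp
qed

lemma antiperiodic_4_block:
  fixes f :: "int \<Rightarrow> int"
  assumes "\<And>i. f (i + 4) = - f i"
  shows "f (i + 4 * int j) = parity_sign (int j) * f i"
proof (induction j)
  case (Suc j)
  have "f (i + 4 * int (Suc j)) = - f (i + 4 * int j)"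
    using assms[of "i + 4 * int j"] by (simp add: algebra_simps)
  then show ?case using Suc by (simp add: parity_sign_def)
qed (simp add: parity_sign_def)

text \<open>Within a residue class modulo 4 the values of f agree up to the alternating sign built
  into \<open>class_sum\<close>; the class of 0 cancels and that of 3 is minus that of 1.\<close>

lemma correlation_eq:
  fixes f :: "int \<Rightarrow> int"
  assumes f: "\<And>i. f (i + 4) = - f i"
  shows "(\<Sum>j<4 * t. \<phi> (int j) * f (int j + k)) =
    class_sum 1 * f (k + 1) + class_sum 2 * f (k + 2) - class_sum 1 * f (k + 3)"
proof -
  have blk: "f (int (4 * j + r) + k) = parity_sign (int j) * f (k + int r)" for j r
    using antiperiodic_4_block[of f "k + int r" j, OF f] by (simp add: algebra_simps)
  have "(\<Sum>j<4 * t. \<phi> (int j) * f (int j + k)) =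
    (\<Sum>j<t. parity_sign (int j) * \<phi> (4 * int j + 0) * f k + parity_sign (int j) * \<phi> (4 * int j + 1) * f (k + 1) +
      parity_sign (int j) * \<phi> (4 * int j + 2) * f (k + 2) + parity_sign (int j) * \<phi> (4 * int j + 3) * f (k + 3))"
    unfolding sum_lessThan_4_times
    using blk[of _ 0] blk[of _ 1] blk[of _ 2] blk[of _ 3] by (intro sum.cong refl) (simp add: add.commute)
  also have "\<dots> = class_sum 0 * f k + class_sum 1 * f (k + 1) + class_sum 2 * f (k + 2) + class_sum 3 * f (k + 3)"
    by (simp add: class_sum_def sum.distrib sum_distrib_right)
  finally show ?thesis by (simp add: class_sum_0 class_sum_3)
qed

end

text \<open>The squared length of (I + S) x: the cross term vanishes because S is skew, and |x|^2 +
  q |x|^2 remains.\<close>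

lemma skew_conference_norm:
  fixes S :: "nat \<Rightarrow> nat \<Rightarrow> int" and x :: "nat \<Rightarrow> int"
  assumes skew: "\<And>a b. a < n \<Longrightarrow> b < n \<Longrightarrow> S b a = - S a b"
    and orth: "\<And>a c. a < n \<Longrightarrow> c < n \<Longrightarrow> (\<Sum>b<n. S a b * S c b) = (if a = c then q else 0)"
  shows "(\<Sum>a<n. (x a + (\<Sum>b<n. S a b * x b))\<^sup>2) = (q + 1) * (\<Sum>a<n. (x a)\<^sup>2)"
proof -
  have cross: "(\<Sum>a<n. \<Sum>b<n. x a * S a b * x b) = 0"
  proof -
    have "(\<Sum>a<n. \<Sum>b<n. x a * S a b * x b) = (\<Sum>b<n. \<Sum>a<n. x a * S a b * x b)" by (rule sum.swap)
    also have "\<dots> = (\<Sum>b<n. \<Sum>a<n. - (x b * S b a * x a))"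
    proof (intro sum.cong refl)
      fix b a assume "b \<in> {..<n}" "a \<in> {..<n}"
      then have "S b a = - S a b" by (intro skew) auto
      then show "x a * S a b * x b = - (x b * S b a * x a)" by simp
    qed
    also have "\<dots> = - (\<Sum>a<n. \<Sum>b<n. x a * S a b * x b)" by (simp add: sum_negf)
    finally show ?thesis by simp
  qed
  have "(\<Sum>a<n. (\<Sum>b<n. S a b * x b)\<^sup>2) = (\<Sum>a<n. \<Sum>b<n. \<Sum>c<n. (x b * x c) * (S b a * S c a))"
  proof (intro sum.cong refl)
    fix a assume a: "a \<in> {..<n}"
    have "(\<Sum>b<n. S a b * x b)\<^sup>2 = (\<Sum>b<n. \<Sum>c<n. (S a b * x b) * (S a c * x c))"
      by (simp add: power2_eq_square sum_product)
    \<comment> \<open>\<open>orth\<close> speaks of rows; two changes of sign turn the columns b and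
      c into rows.\<close>
    also have "\<dots> = (\<Sum>b<n. \<Sum>c<n. (x b * x c) * (S b a * S c a))"
    proof (intro sum.cong refl)
      fix b c assume "b \<in> {..<n}" "c \<in> {..<n}"
      then have "S b a = - S a b" "S c a = - S a c" using a by (auto intro: skew)
      then show "(S a b * x b) * (S a c * x c) = (x b * x c) * (S b a * S c a)" by simp
    qed
    finally show "(\<Sum>b<n. S a b * x b)\<^sup>2 = (\<Sum>b<n. \<Sum>c<n. (x b * x c) * (S b a * S c a))" .
  qed
  also have "\<dots> = (\<Sum>b<n. \<Sum>a<n. \<Sum>c<n. (x b * x c) * (S b a * S c a))"
    by (rule sum.swap)
  also have "\<dots> = (\<Sum>b<n. \<Sum>c<n. \<Sum>a<n. (x b * x c) * (S b a * S c a))"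
    by (intro sum.cong refl sum.swap)
  also have "\<dots> = (\<Sum>b<n. \<Sum>c<n. if b = c then q * (x b)\<^sup>2 else 0)"
  proof (intro sum.cong refl)
    fix b c assume "b \<in> {..<n}" "c \<in> {..<n}"
    then have "(\<Sum>a<n. S b a * S c a) = (if b = c then q else 0)" by (intro orth) auto
    then show "(\<Sum>a<n. (x b * x c) * (S b a * S c a)) = (if b = c then q * (x b)\<^sup>2 else 0)"
      by (simp add: power2_eq_square flip: sum_distrib_left)
  qed
  also have "\<dots> = q * (\<Sum>a<n. (x a)\<^sup>2)" by (simp add: sum_distrib_left)
  finally have sq: "(\<Sum>a<n. (\<Sum>b<n. S a b * x b)\<^sup>2) = q * (\<Sum>a<n. (x a)\<^sup>2)" .
  have "(\<Sum>a<n. (x a + (\<Sum>b<n. S a b * x b))\<^sup>2) =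
      (\<Sum>a<n. (x a)\<^sup>2 + 2 * (\<Sum>b<n. x a * S a b * x b) + (\<Sum>b<n. S a b * x b)\<^sup>2)"
    by (intro sum.cong refl) (simp add: power2_sum sum_distrib_left algebra_simps)
  also have "\<dots> = (\<Sum>a<n. (x a)\<^sup>2) + 2 * (\<Sum>a<n. \<Sum>b<n. x a * S a b * x b) + (\<Sum>a<n. (\<Sum>b<n. S a b * x b)\<^sup>2)"
    by (simp add: sum.distrib sum_distrib_left)
  finally show ?thesis unfolding cross sq by (simp add: algebra_simps)
qed

text \<open>Point a of the projective line is represented by g to the power \<open>k a\<close>;
  distinct points differ modulo the scalars, which are the powers of g^(4 t). The formula for S is
  the character of the determinant Im(cj u * v), computed with cj g^i = g^(q i).\<close>

locale paley_type = reflective_antiperiodic +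
  fixes k :: "nat \<Rightarrow> int" and S :: "nat \<Rightarrow> nat \<Rightarrow> int"
  assumes inj_k: "inj_on (\<lambda>a. k a mod (4 * int t)) {..<4 * t}"
    and S_eq: "\<And>a b. a < 4 * t \<Longrightarrow> b < 4 * t \<Longrightarrow> S a b = parity_sign (k a) * \<phi> (k b - k a)"
    and S_skew: "\<And>a b. a < 4 * t \<Longrightarrow> b < 4 * t \<Longrightarrow> S b a = - S a b"
    and S_orth: "\<And>a c. a < 4 * t \<Longrightarrow> c < 4 * t \<Longrightarrow>
      (\<Sum>b<4 * t. S a b * S c b) = (if a = c then 4 * int t - 1 else 0)"
begin

text \<open>The entry of (I + S) x at a point with exponent i, where x is f composed with k; see
  \<open>transform_eq\<close>.\<close>

definition transform :: "(int \<Rightarrow> int) \<Rightarrow> int \<Rightarrow> int" where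
  "transform f i = f i + parity_sign i * (class_sum 1 * f (i + 1) + class_sum 2 * f (i + 2) - class_sum 1 * f (i + 3))"

lemma transform_antiperiodic:
  assumes "\<And>i. f (i + 4) = - f i"
  shows "transform f (i + 4) = - transform f i"
  using assms[of i] assms[of "i + 1"] assms[of "i + 2"] assms[of "i + 3"]
  by (simp add: transform_def parity_sign_def algebra_simps)

lemma transform_eq:
  assumes f: "\<And>i. f (i + 4) = - f i" and a: "a < 4 * t"
  shows "f (k a) + (\<Sum>b<4 * t. S a b * f (k b)) = transform f (k a)"
proof -
  have "(\<Sum>b<4 * t. S a b * f (k b)) = parity_sign (k a) * (\<Sum>b<4 * t. \<phi> (k b - k a) * f (k b - k a + k a))"
    using S_eq[OF a] by (simp add: sum_distrib_left mult.assoc)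
  \<comment> \<open>Both factors change sign under a shift by 4 t, f because t is odd, so the
    product depends only on the residue modulo 4 t; and \<open>k b - k a\<close> runs through all
    residues.\<close>
  also have "(\<Sum>b<4 * t. \<phi> (k b - k a) * f (k b - k a + k a)) = (\<Sum>j<4 * t. \<phi> (int j) * f (int j + k a))"
  proof (rule sum_periodic_complete_residues)
    show "\<phi> (i + int (4 * t)) * f (i + int (4 * t) + k a) = \<phi> i * f (i + k a)" for i
      using antiperiodic[of i] antiperiodic_4_block[of f "i + k a" t, OF f] odd_t
      by (simp add: parity_sign_def algebra_simps)
    show "inj_on (\<lambda>b. (k b - k a) mod int (4 * t)) {..<4 * t}"
    proof (rule inj_onI)
      fix x y assume xy: "x \<in> {..<4 * t}" "y \<in> {..<4 * t}"
        and "(k x - k a) mod int (4 * t) = (k y - k a) mod int (4 * t)"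
      then have "4 * int t dvd (k x - k a) - (k y - k a)" by (simp add: mod_eq_dvd_iff)
      then have "k x mod (4 * int t) = k y mod (4 * int t)" by (simp add: mod_eq_dvd_iff)
      then show "x = y" using inj_k xy by (auto dest: inj_onD)
    qed
  qed (use t_pos in auto)
  finally show ?thesis using correlation_eq[of f "k a", OF f] by (simp add: transform_def)
qed

lemma sum_transform_squares:
  assumes f: "\<And>i. f (i + 4) = - f i"
  shows "(\<Sum>a<4 * t. (transform f (k a))\<^sup>2) = 4 * int t * (\<Sum>a<4 * t. (f (k a))\<^sup>2)"
proof -
  have "(\<Sum>a<4 * t. (transform f (k a))\<^sup>2) = (\<Sum>a<4 * t. (f (k a) + (\<Sum>b<4 * t. S a b * f (k b)))\<^sup>2)"
    using transform_eq[of f, OF f] by simp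
  also have "\<dots> = 4 * int t * (\<Sum>a<4 * t. (f (k a))\<^sup>2)"
    using skew_conference_norm[of "4 * t" S "4 * int t - 1" "\<lambda>a. f (k a)", OF S_skew S_orth] by simp
  finally show ?thesis .
qed

text \<open>The norm identity evaluated on one convenient pattern f: the values of the transform at
  0, ..., 3 are 1 + B, 1 - 2 A - B, 1 + 2 A - B and 1 + B, whose squares add up to 4 + 4 B^2 + 8
  A^2.\<close>

lemma class_sum_norm: "(class_sum 2)\<^sup>2 + 2 * (class_sum 1)\<^sup>2 = 4 * int t - 1"
proof -
  define f :: "int \<Rightarrow> int" where "f i = (if i mod 8 < 4 then 1 else - 1)" for i
  have f: "f (i + 4) = - f i" for i
  proof -
    have "(i + 4) mod 8 < 4 \<longleftrightarrow> \<not> i mod 8 < 4" by presburger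
    then show ?thesis by (simp add: f_def)
  qed
  have [simp]: "f 0 = 1" "f 1 = 1" "f 2 = 1" "f 3 = 1" "f 4 = - 1" "f 5 = - 1" "f 6 = - 1"
    by (simp_all add: f_def)
  have f2: "(f i)\<^sup>2 = 1" for i by (simp add: f_def)
  let ?A = "class_sum 1" and ?B = "class_sum 2"
  have per: "(transform f (i + 4 * int j))\<^sup>2 = (transform f i)\<^sup>2" for i j
    using antiperiodic_4_block[of "transform f" i j, OF transform_antiperiodic[of f, OF f]]
    by (simp add: parity_sign_def)
  have "16 * int t * int t = (\<Sum>a<4 * t. (transform f (k a))\<^sup>2)"
    unfolding sum_transform_squares[of f, OF f] by (simp add: f2)
  also have "\<dots> = (\<Sum>j<4 * t. (transform f (int j))\<^sup>2)"
    using per[of _ t] inj_k t_pos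
    by (intro sum_periodic_complete_residues[where F = "\<lambda>i. (transform f i)\<^sup>2"]) auto
  also have "\<dots> = (\<Sum>j<t. (transform f 0)\<^sup>2 + (transform f 1)\<^sup>2 + (transform f 2)\<^sup>2 + (transform f 3)\<^sup>2)"
    unfolding sum_lessThan_4_times
    using per[of 0] per[of 1] per[of 2] per[of 3] by (intro sum.cong refl) (simp add: add.commute)
  also have "\<dots> = int t * (4 + 4 * ?B\<^sup>2 + 8 * ?A\<^sup>2)"
    by (simp add: transform_def parity_sign_def power2_eq_square algebra_simps)
  finally have "int t * (16 * int t) = int t * (4 + 4 * ?B\<^sup>2 + 8 * ?A\<^sup>2)" by (simp add: mult_ac)
  then have "16 * int t = 4 + 4 * ?B\<^sup>2 + 8 * ?A\<^sup>2" using t_pos by simp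
  then show ?thesis by simp
qed

text \<open>
  Each value of the transform is plus or minus \<open>2 * m + 1\<close> plus three signs. The sum of the three
  signs, normalised by the sign of the large term, is \<open>1\<close> or \<open>- 3\<close> exactly when the product of all
  four signs is \<open>- 1\<close>; in every residue class this product is the same, and it depends
  only on the sign of \<open>class_sum 2\<close> and on the product of the four values of the sign pattern.
\<close>
lemma exists_two_valued_transform:
  assumes A: "(class_sum 1)\<^sup>2 = 1" and B: "(class_sum 2)\<^sup>2 = (2 * m + 1)\<^sup>2" and "m \<ge> 0"
  obtains f where "\<And>i. f i = 1 \<or> f i = - 1" "\<And>i. f (i + 4) = - f i"
    "\<And>i. \<bar>transform f i\<bar> = \<bar>2 * m - 2\<bar> \<or> \<bar>transform f i\<bar> = 2 * m + 2"
proof -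
  obtain e where e: "e = 1 \<or> e = - 1" "class_sum 2 = e * (2 * m + 1)"
  proof (cases "class_sum 2 = 2 * m + 1")
    case True
    then show ?thesis using that[of 1] by simp
  next
    case False
    then have "class_sum 2 = - (2 * m + 1)" using B unfolding power2_eq_iff by blast
    then show ?thesis using that[of "- 1"] by simp
  qed
  have A': "class_sum 1 = 1 \<or> class_sum 1 = - 1" using A by (simp add: power2_eq_1_iff)
  \<comment> \<open>The factor e on the multiples of 4 gives the values at 0, ..., 3 the product e,
    the sign of \<open>class_sum 2\<close>; this makes the product of the four signs - 1.\<close>
  define f :: "int \<Rightarrow> int" where
    "f i = (if i mod 8 < 4 then 1 else - 1) * (if i mod 4 = 0 then e else 1)" for i
  have f: "f (i + 4) = - f i" for i
  proof -
    have "(i + 4) mod 8 < 4 \<longleftrightarrow> \<not> i mod 8 < 4" "(i + 4) mod 4 = i mod 4" by presburger+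
    then show ?thesis by (simp add: f_def)
  qed
  have [simp]: "f 0 = e" "f 1 = 1" "f 2 = 1" "f 3 = 1" "f 4 = - e" "f 5 = - 1" "f 6 = - 1"
    by (simp_all add: f_def)
  define Q where "Q i \<longleftrightarrow> \<bar>transform f i\<bar> = \<bar>2 * m - 2\<bar> \<or> \<bar>transform f i\<bar> = 2 * m + 2" for i
  have "Q (i + 4) = Q i" for i
    using transform_antiperiodic[of f i, OF f] by (simp add: Q_def)
  then have "Q i = Q (i mod 4)" for i using periodic_mod[of Q 4] by simp
  moreover have "Q (i mod 4)" for i
  proof -
    have "i mod 4 = 0 \<or> i mod 4 = 1 \<or> i mod 4 = 2 \<or> i mod 4 = 3" by presburger
    moreover have "Q 0" "Q 1" "Q 2" "Q 3"
      using A' e \<open>m \<ge> 0\<close> by (auto simp: Q_def transform_def parity_sign_def)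
    ultimately show ?thesis by auto
  qed
  ultimately have "Q i" for i by simp
  moreover have "f i = 1 \<or> f i = - 1" for i using e by (auto simp: f_def)
  ultimately show ?thesis using that[of f] f by (simp add: Q_def)
qed

end

section \<open>From a two-valued transform to a biregular matrix of maximum excess\<close>

lemma skew_conference_switching:
  fixes S :: "nat \<Rightarrow> nat \<Rightarrow> int" and B :: "int mat" and d x :: "nat \<Rightarrow> int" and m :: int
  assumes n: "int n = 4 * m\<^sup>2 + 4 * m + 4" and m: "m \<ge> 0"
    and Bc: "B \<in> carrier_mat n n"
    and B: "\<And>a b. a < n \<Longrightarrow> b < n \<Longrightarrow> B $$ (a, b) = d a * ((if a = b then 1 else 0) + S a b)"
    and d: "\<And>a. d a = 1 \<or> d a = - 1"
    and diag: "\<And>a. a < n \<Longrightarrow> S a a = 0"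
    and off: "\<And>a b. a < n \<Longrightarrow> b < n \<Longrightarrow> a \<noteq> b \<Longrightarrow> S a b = 1 \<or> S a b = - 1"
    and skew: "\<And>a b. a < n \<Longrightarrow> b < n \<Longrightarrow> S b a = - S a b"
    and orth: "\<And>a c. a < n \<Longrightarrow> c < n \<Longrightarrow> (\<Sum>b<n. S a b * S c b) = (if a = c then int n - 1 else 0)"
    and x: "\<And>a. x a = 1 \<or> x a = - 1"
    and v: "\<And>a. a < n \<Longrightarrow> v a = x a + (\<Sum>b<n. S a b * x b)"
    and vals: "\<And>a. a < n \<Longrightarrow> \<bar>v a\<bar> = \<bar>2 * m - 2\<bar> \<or> \<bar>v a\<bar> = 2 * m + 2"
    and norm: "(\<Sum>a<n. (v a)\<^sup>2) = int n * int n"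
  obtains R C where "R \<subseteq> {..<n}" "C \<subseteq> {..<n}"
    "hadamard_mat n (negate_rows_cols R C B)"
    "m > 0 \<Longrightarrow> biregular (negate_rows_cols R C B)"
    "excess (negate_rows_cols R C B) = (if m = 0 then 8 else int n * (2 * m + 1))"
proof -
  \<comment> \<open>\<open>sg 0\<close> is 1 and not 0: for m = 1 the entry \<open>v a\<close> may
    vanish, and its row must still keep entries 1 and - 1.\<close>
  define sg :: "int \<Rightarrow> int" where "sg w = (if w < 0 then - 1 else 1)" for w
  \<comment> \<open>The factor \<open>d a\<close> removes the row sign by which B differs from I +
    S; the factor \<open>sg (v a)\<close> turns the row sum \<open>v a\<close> into its absolute
    value.\<close>
  define R where "R = {a \<in> {..<n}. d a * sg (v a) = - 1}"
  define C where "C = {b \<in> {..<n}. x b = - 1}"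
  define H where "H = negate_rows_cols R C B"
  have "int n > 0" unfolding n using m zero_le_power2[of m] by linarith
  then have n0: "n > 0" by simp
  have sg: "sg w = 1 \<or> sg w = - 1" "sg w * w = \<bar>w\<bar>" "sg w * sg w = 1" for w by (auto simp: sg_def)
  have xx: "x b * x b = 1" for b using x[of b] by auto
  have Hc: "H \<in> carrier_mat n n" using Bc by (auto simp: H_def negate_rows_cols_def)
  have He: "H $$ (a, b) = sg (v a) * x b * ((if a = b then 1 else 0) + S a b)" if "a < n" "b < n" for a b
  proof -
    have "(if a \<in> R then - 1 else 1) = d a * sg (v a)" using d[of a] sg(1)[of "v a"] that by (auto simp: R_def)
    moreover have "(if b \<in> C then - 1 else 1) = x b" using x[of b] that by (auto simp: C_def)
    ultimately have "H $$ (a, b) = (d a * sg (v a)) * x b * B $$ (a, b)"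
      using Bc that by (simp add: H_def negate_rows_cols_def)
    also have "\<dots> = (d a * d a) * (sg (v a) * x b * ((if a = b then 1 else 0) + S a b))"
      unfolding B[OF that] by (simp only: mult_ac)
    also have "d a * d a = 1" using d[of a] by auto
    finally show ?thesis by simp
  qed
  have rowsum: "(\<Sum>b<n. H $$ (a, b)) = \<bar>v a\<bar>" if a: "a < n" for a
  proof -
    have "(\<Sum>b<n. H $$ (a, b)) = (\<Sum>b<n. sg (v a) * ((if a = b then x b else 0) + S a b * x b))"
      using a by (intro sum.cong refl) (auto simp: He algebra_simps)
    also have "\<dots> = sg (v a) * v a"
      using a by (simp add: v sum.distrib flip: sum_distrib_left)
    finally show ?thesis by (simp add: sg)
  qed
  have had: "hadamard_mat n H"
    unfolding hadamard_mat_def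
  proof (intro conjI)
    show "H \<in> carrier_mat n n" by (rule Hc)
    show "elements_mat H \<subseteq> {1, - 1}"
    proof
      fix w assume "w \<in> elements_mat H"
      then obtain a b where ab: "a < n" "b < n" "w = H $$ (a, b)" using Hc by (auto simp: elements_mat_def)
      have "(if a = b then 1 else 0) + S a b = 1 \<or> (if a = b then 1 else 0) + S a b = - 1"
        using diag off[of a b] ab by auto
      then show "w \<in> {1, - 1}" using sg(1)[of "v a"] x[of b] by (auto simp: ab He)
    qed
    show "H * transpose_mat H = int n \<cdot>\<^sub>m 1\<^sub>m n"
    proof (rule eq_matI)
      fix a c assume "a < dim_row (int n \<cdot>\<^sub>m 1\<^sub>m n :: int mat)" "c < dim_col (int n \<cdot>\<^sub>m 1\<^sub>m n :: int mat)"
      then have ac: "a < n" "c < n" by auto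
      have "(H * transpose_mat H) $$ (a, c) = (\<Sum>b<n. H $$ (a, b) * H $$ (c, b))"
        using ac Hc by (simp add: scalar_prod_def lessThan_atLeast0)
      also have "\<dots> = (\<Sum>b<n. sg (v a) * sg (v c) *
          ((if a = b then (if a = c then 1 else 0) + S c a else 0) + (if c = b then S a c else 0) + S a b * S c b))"
      proof (intro sum.cong refl)
        fix b assume "b \<in> {..<n}"
        then have b: "b < n" by simp
        have "H $$ (a, b) * H $$ (c, b) = sg (v a) * sg (v c) * (x b * x b) *
           (((if a = b then 1 else 0) + S a b) * ((if c = b then 1 else 0) + S c b))"
          by (simp add: He ac b)
        also have "\<dots> = sg (v a) * sg (v c) *
          ((if a = b then (if a = c then 1 else 0) + S c a else 0) + (if c = b then S a c else 0) + S a b * S c b)"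
          by (auto simp: xx algebra_simps)
        finally show "H $$ (a, b) * H $$ (c, b) = sg (v a) * sg (v c) *
          ((if a = b then (if a = c then 1 else 0) + S c a else 0) + (if c = b then S a c else 0) + S a b * S c b)" .
      qed
      also have "\<dots> = sg (v a) * sg (v c) * ((if a = c then 1 else 0) + S c a + S a c + (\<Sum>b<n. S a b * S c b))"
        using ac by (simp add: sum.distrib flip: sum_distrib_left)
      also have "\<dots> = (if a = c then int n else 0)"
        using ac by (auto simp: orth skew[OF ac] sg diag)
      also have "\<dots> = (int n \<cdot>\<^sub>m 1\<^sub>m n) $$ (a, c)" using ac by simp
      finally show "(H * transpose_mat H) $$ (a, c) = (int n \<cdot>\<^sub>m 1\<^sub>m n) $$ (a, c)" .
    qed (use Hc in auto)
  qed
  have ex: "excess H = (\<Sum>a<n. \<bar>v a\<bar>)"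
    using Hc rowsum by (simp add: excess_def)
  have exval: "excess H = (if m = 0 then 8 else int n * (2 * m + 1))"
  proof (cases "m = 0")
    \<comment> \<open>For m = 0 both admissible values are 2, and the computation of the other case
      would divide by m.\<close>
    case True
    then have "n = 4" using n by simp
    have "(\<Sum>a<n. \<bar>v a\<bar>) = (\<Sum>a<n. 2)" using vals True by (intro sum.cong refl) auto
    then show ?thesis using True \<open>n = 4\<close> ex by simp
  next
    case False
    then have m1: "m \<ge> 1" using m by simp
    \<comment> \<open>Both admissible values are roots of w^2 - 4 m w + 4 m^2 - 4, so the sum of the
      squares determines the sum of the absolute values.\<close>
    have "(v a)\<^sup>2 = 4 * m * \<bar>v a\<bar> - (4 * m\<^sup>2 - 4)" if "a < n" for a
    proof -
      have "\<bar>v a\<bar> = 2 * m - 2 \<or> \<bar>v a\<bar> = 2 * m + 2" using vals[OF that] m1 by auto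
      moreover have "w * w = 4 * m * w - (4 * m\<^sup>2 - 4)" if "w = 2 * m - 2 \<or> w = 2 * m + 2" for w
        using that by (elim disjE; hypsubst; simp add: power2_eq_square algebra_simps)
      ultimately have "\<bar>v a\<bar> * \<bar>v a\<bar> = 4 * m * \<bar>v a\<bar> - (4 * m\<^sup>2 - 4)" by blast
      then show ?thesis by (simp add: power2_eq_square)
    qed
    then have "(\<Sum>a<n. (v a)\<^sup>2) = (\<Sum>a<n. 4 * m * \<bar>v a\<bar> - (4 * m\<^sup>2 - 4))" by simp
    also have "\<dots> = 4 * m * excess H - int n * (4 * m\<^sup>2 - 4)"
      by (simp add: ex sum_subtractf sum_distrib_left)
    finally have "4 * m * excess H = int n * (int n + (4 * m\<^sup>2 - 4))"
      using norm by (simp add: algebra_simps)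
    also have "int n + (4 * m\<^sup>2 - 4) = 4 * m * (2 * m + 1)"
      unfolding n by (simp add: power2_eq_square algebra_simps)
    finally have "4 * m * excess H = 4 * m * (int n * (2 * m + 1))" by (simp add: algebra_simps)
    then show ?thesis using m1 by simp
  qed
  have bireg: "biregular H" if "m > 0"
  proof -
    have "vec_set (H *\<^sub>v vec (dim_col H) (\<lambda>_. 1)) = (\<lambda>a. \<bar>v a\<bar>) ` {..<n}"
    proof -
      have "(H *\<^sub>v vec (dim_col H) (\<lambda>_. 1)) $ a = \<bar>v a\<bar>" if "a < n" for a
        using Hc that rowsum[OF that] by (simp add: scalar_prod_def lessThan_atLeast0)
      then show ?thesis using Hc by (auto simp: vec_set_def image_def)
    qed
    moreover have "(\<lambda>a. \<bar>v a\<bar>) ` {..<n} = {2 * m - 2, 2 * m + 2}"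
    proof -
      have sub: "\<bar>v a\<bar> = 2 * m - 2 \<or> \<bar>v a\<bar> = 2 * m + 2" if "a < n" for a
        using vals[OF that] \<open>m > 0\<close> by auto
      \<comment> \<open>If all row sums were equal to c, then n c^2 = n^2; but the squares of 2 m -
        2 and 2 m + 2 are n - 12 m and n + 4 m.\<close>
      have occ: "\<exists>a<n. \<bar>v a\<bar> \<noteq> c" if "c * c \<noteq> int n" for c
      proof (rule ccontr)
        assume "\<not> (\<exists>a<n. \<bar>v a\<bar> \<noteq> c)"
        then have "(v a)\<^sup>2 = c * c" if "a < n" for a
          using that by (metis abs_mult_self_eq power2_eq_square)
        then have "(\<Sum>a<n. (v a)\<^sup>2) = int n * (c * c)" by simp
        then have "c * c = int n" using norm n0 by simp
        then show False using that by simp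
      qed
      have "(2 * m - 2) * (2 * m - 2) = int n - 12 * m" "(2 * m + 2) * (2 * m + 2) = int n + 4 * m"
        unfolding n by (simp_all add: power2_eq_square algebra_simps)
      then have "\<exists>a<n. \<bar>v a\<bar> \<noteq> 2 * m - 2" "\<exists>a<n. \<bar>v a\<bar> \<noteq> 2 * m + 2"
        using \<open>m > 0\<close> by (auto intro!: occ)
      then obtain a a' where "a < n" "\<bar>v a\<bar> = 2 * m + 2" "a' < n" "\<bar>v a'\<bar> = 2 * m - 2" using sub by metis
      then have "2 * m + 2 \<in> (\<lambda>a. \<bar>v a\<bar>) ` {..<n}" "2 * m - 2 \<in> (\<lambda>a. \<bar>v a\<bar>) ` {..<n}"
        by (metis imageI lessThan_iff)+
      then show ?thesis using sub by auto
    qed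
    ultimately show ?thesis using \<open>m > 0\<close> by (simp add: biregular_def)
  qed
  show ?thesis
    using that[of R C] had bireg exval unfolding H_def by (auto simp: R_def C_def)
qed

section \<open>The quadratic character of a finite field\<close>

text \<open>The cyclic multiplicative group as an exponential map on the integers, so that equality
  of elements becomes divisibility of a difference of exponents.\<close>

lemma (in field) finite_field_exponential:
  assumes fin: "finite (carrier R)"
  obtains gp :: "int \<Rightarrow> 'a" where "\<And>i. gp i \<in> carrier R" "\<And>i. gp i \<noteq> \<zero>" "gp 0 = \<one>"
    "\<And>i j. gp (i + j) = gp i \<otimes> gp j"
    "\<And>x. x \<in> carrier R \<Longrightarrow> x \<noteq> \<zero> \<Longrightarrow> \<exists>i. x = gp i"
    "\<And>i j. gp i = gp j \<longleftrightarrow> int (card (carrier R) - 1) dvd i - j"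
proof -
  let ?G = "Multiplicative_Group.mult_of R"
  interpret G: group ?G by (rule field_mult_group)
  obtain g where g: "g \<in> carrier ?G" "carrier ?G = {g [^] i | i::nat. i \<in> UNIV}"
    using finite_field_mult_group_has_gen[OF fin] by blast
  have ordG: "order ?G = card (carrier R) - 1" using order_mult_of fin by (simp add: order_def)
  have finG: "finite (carrier ?G)" using fin by simp
  have "carrier ?G = (\<lambda>i::nat. g [^]\<^bsub>?G\<^esub> i) ` {0..G.ord g - 1}"
    using G.ord_elems[OF finG g(1)] g(2) by (auto simp: Multiplicative_Group.nat_pow_mult_of)
  then have "order ?G \<le> card {0..G.ord g - 1}" unfolding order_def by (metis card_image_le finite_atLeastAtMost)
  then have "order ?G \<le> G.ord g" using G.ord_ge_1[OF finG g(1)] by simp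
  moreover have "G.ord g \<le> order ?G" by (rule G.ord_le_group_order[OF finG g(1)])
  ultimately have ord: "G.ord g = card (carrier R) - 1" using ordG by simp
  define gp where "gp i = g [^]\<^bsub>?G\<^esub> (i::int)" for i
  have gpc: "gp i \<in> carrier ?G" for i unfolding gp_def using g(1) by (rule G.int_pow_closed)
  show ?thesis
  proof (rule that[of gp])
    show "gp i \<in> carrier R" "gp i \<noteq> \<zero>" for i using gpc[of i] by auto
    show "gp 0 = \<one>" by (simp add: gp_def)
    show "gp (i + j) = gp i \<otimes> gp j" for i j
      using G.int_pow_mult[OF g(1), of i j] by (simp add: gp_def)
    show "\<exists>i. x = gp i" if x: "x \<in> carrier R" "x \<noteq> \<zero>" for x
    proof -
      have "x \<in> carrier ?G" using x by simp
      then obtain i :: nat where "x = g [^]\<^bsub>?G\<^esub> i"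
        unfolding g(2) by (auto simp: Multiplicative_Group.nat_pow_mult_of)
      then have "x = gp (int i)" by (simp add: gp_def int_pow_int)
      then show ?thesis by blast
    qed
    show "gp i = gp j \<longleftrightarrow> int (card (carrier R) - 1) dvd i - j" for i j
      unfolding gp_def using G.int_pow_eq[OF g(1), of i j] ord by (auto simp: dvd_diff_commute)
  qed
qed

lemma (in monoid) exponential_nat_pow:
  fixes gp :: "int \<Rightarrow> 'a"
  assumes "\<And>i. gp i \<in> carrier G" "gp 0 = \<one>" "\<And>i j. gp (i + j) = gp i \<otimes> gp j"
  shows "gp i [^] (n::nat) = gp (i * int n)"
  using assms(1) by (induction n) (auto simp: assms(2) algebra_simps simp flip: assms(3))

lemma (in domain) square_eq_one_imp_minus_one:
  assumes x: "x \<in> carrier R" and "x \<otimes> x = \<one>" "x \<noteq> \<one>"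
  shows "x = \<ominus> \<one>"
proof -
  have "(x \<ominus> \<one>) \<otimes> (x \<oplus> \<one>) = x \<otimes> x \<ominus> \<one>" using x by algebra
  then have "(x \<ominus> \<one>) \<otimes> (x \<oplus> \<one>) = \<zero>" using assms(2) by (simp add: minus_eq r_neg)
  then have "x \<oplus> \<one> = \<zero>" using x \<open>x \<noteq> \<one>\<close> integral[of "x \<ominus> \<one>" "x \<oplus> \<one>"] by auto
  then show ?thesis using x minus_equality[of x \<one>] by simp
qed

text \<open>With q = 3 modulo 4, - 1 is a nonsquare: the quadratic character is odd, and X^2 + 1 is
  irreducible over F.\<close>

locale finite_field_3_mod_4 = field F for F (structure) + fixes q :: nat
  assumes card_carrier: "card (carrier F) = q" and q_mod_4: "q mod 4 = 3"
begin

definition is_square :: "'a \<Rightarrow> bool" where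
  "is_square c \<longleftrightarrow> (\<exists>y\<in>carrier F. c = y \<otimes> y)"

definition eta :: "'a \<Rightarrow> int" where
  "eta c = (if c = \<zero> then 0 else if is_square c then 1 else - 1)"

lemma q_ge_3: "q \<ge> 3" using q_mod_4 by presburger

lemma finite_carrier: "finite (carrier F)"
  using card_carrier q_ge_3 by (intro card_ge_0_finite) simp

lemma add_pow_q: "[q] \<cdot> \<one> = \<zero>"
  using add_pow_card_carrier[of \<one>] card_carrier by simp

lemma eta_range: "eta c = 0 \<or> eta c = 1 \<or> eta c = - 1"
  by (simp add: eta_def)

lemma eta_eq_0_iff: "eta c = 0 \<longleftrightarrow> c = \<zero>"
  by (simp add: eta_def)

lemma eta_zero [simp]: "eta \<zero> = 0"
  by (simp add: eta_def)

lemma eta_one [simp]: "eta \<one> = 1"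
  by (auto simp: eta_def is_square_def intro: bexI[of _ \<one>])

text \<open>As q - 1 is even, the parity of an exponent is well defined and distinguishes squares
  from nonsquares. Multiplicativity, the value at - 1 and Euler's criterion are then read off from
  exponents.\<close>

lemma eta_euler_exponential:
  obtains gp :: "int \<Rightarrow> 'a" where "\<And>i. gp i \<in> carrier F" "\<And>i. gp i \<noteq> \<zero>" "gp 0 = \<one>"
    "\<And>i j. gp (i + j) = gp i \<otimes> gp j"
    "\<And>x. x \<in> carrier F \<Longrightarrow> x \<noteq> \<zero> \<Longrightarrow> \<exists>i. x = gp i"
    "\<And>i j. gp i = gp j \<longleftrightarrow> int (q - 1) dvd i - j"
    "\<And>i. eta (gp i) = (if even i then 1 else - 1)"
    "gp (int ((q - 1) div 2)) = \<ominus> \<one>"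
proof -
  obtain gp :: "int \<Rightarrow> 'a" where gp: "\<And>i. gp i \<in> carrier F" "\<And>i. gp i \<noteq> \<zero>" "gp 0 = \<one>"
    "\<And>i j. gp (i + j) = gp i \<otimes> gp j"
    "\<And>x. x \<in> carrier F \<Longrightarrow> x \<noteq> \<zero> \<Longrightarrow> \<exists>i. x = gp i"
    "\<And>i j. gp i = gp j \<longleftrightarrow> int (q - 1) dvd i - j"
    using finite_field_exponential[OF finite_carrier] unfolding card_carrier by blast
  have ev: "even (q - 1)" using q_mod_4 by presburger
  have sq: "is_square (gp i) \<longleftrightarrow> even i" for i
  proof
    assume "is_square (gp i)"
    then obtain y where y: "y \<in> carrier F" "gp i = y \<otimes> y" by (auto simp: is_square_def)
    have "y \<noteq> \<zero>" using y gp(2)[of i] by auto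
    then obtain j where "y = gp j" using gp(5) y by blast
    then have "int (q - 1) dvd i - (j + j)" using y gp(4,6) by metis
    then have "even (i - (j + j))" using ev by (meson dvd_trans even_of_nat)
    then show "even i" by simp
  next
    assume "even i"
    then have "gp i = gp (i div 2) \<otimes> gp (i div 2)" by (simp flip: gp(4))
    then show "is_square (gp i)" using gp(1) by (auto simp: is_square_def)
  qed
  define h where "h = gp (int ((q - 1) div 2))"
  have "int ((q - 1) div 2) + int ((q - 1) div 2) = int (q - 1)" using ev by presburger
  then have "h \<otimes> h = gp (int (q - 1))" unfolding h_def by (simp flip: gp(4))
  also have "\<dots> = \<one>" using gp(6)[of "int (q - 1)" 0] gp(3) by simp
  finally have hh: "h \<otimes> h = \<one>" .
  have "h \<noteq> \<one>"
  proof
    assume "h = \<one>"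
    then have "int (q - 1) dvd int ((q - 1) div 2)" using gp(6)[of "int ((q - 1) div 2)" 0] gp(3) by (simp add: h_def)
    then have "q - 1 \<le> (q - 1) div 2" using q_ge_3 by (intro dvd_imp_le) (auto simp only: of_nat_dvd_iff)
    then show False using q_ge_3 by simp
  qed
  have hc: "h \<in> carrier F" by (simp add: h_def gp)
  have "h = \<ominus> \<one>" by (rule square_eq_one_imp_minus_one) fact+
  then show ?thesis using that[of gp] gp sq by (auto simp: eta_def h_def)
qed

lemma eta_mult:
  assumes "a \<in> carrier F" "b \<in> carrier F"
  shows "eta (a \<otimes> b) = eta a * eta b"
proof (cases "a = \<zero> \<or> b = \<zero>")
  case False
  obtain gp :: "int \<Rightarrow> 'a" where gp: "\<And>i j. gp (i + j) = gp i \<otimes> gp j"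
    "\<And>x. x \<in> carrier F \<Longrightarrow> x \<noteq> \<zero> \<Longrightarrow> \<exists>i. x = gp i"
    "\<And>i. eta (gp i) = (if even i then 1 else - 1)"
    using eta_euler_exponential by metis
  obtain i j where "a = gp i" "b = gp j" using gp(2) False assms by metis
  then have "eta (a \<otimes> b) = eta (gp (i + j))" by (simp add: gp(1))
  then show ?thesis using \<open>a = gp i\<close> \<open>b = gp j\<close> by (simp add: gp(3))
qed (use assms in auto)

lemma eta_minus_one: "eta (\<ominus> \<one>) = - 1"
proof -
  obtain gp :: "int \<Rightarrow> 'a" where gp:
    "\<And>i. eta (gp i) = (if even i then 1 else - 1)"
    "gp (int ((q - 1) div 2)) = \<ominus> \<one>"
    using eta_euler_exponential by metis
  have "odd (int ((q - 1) div 2))" using q_mod_4 by presburger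
  then show ?thesis using gp by metis
qed

lemma eta_minus:
  assumes "a \<in> carrier F"
  shows "eta (\<ominus> a) = - eta a"
  using eta_mult[of "\<ominus> \<one>" a] assms eta_minus_one by (simp add: l_minus)

lemma eta_euler:
  assumes "c \<in> carrier F"
  shows "[(eta c)] \<cdot> \<one> = c [^] ((q - 1) div 2)"
proof (cases "c = \<zero>")
  case True
  have "(q - 1) div 2 > 0" using q_ge_3 by simp
  then show ?thesis using True by (simp add: nat_pow_zero add_pow_int_ge)
next
  case False
  obtain gp :: "int \<Rightarrow> 'a" where gp: "\<And>i. gp i \<in> carrier F" "\<And>i. gp i \<noteq> \<zero>" "gp 0 = \<one>"
    "\<And>i j. gp (i + j) = gp i \<otimes> gp j"
    "\<And>x. x \<in> carrier F \<Longrightarrow> x \<noteq> \<zero> \<Longrightarrow> \<exists>i. x = gp i"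
    "\<And>i j. gp i = gp j \<longleftrightarrow> int (q - 1) dvd i - j"
    "\<And>i. eta (gp i) = (if even i then 1 else - 1)"
    "gp (int ((q - 1) div 2)) = \<ominus> \<one>"
    by (fact eta_euler_exponential)
  define N where "N = int ((q - 1) div 2)"
  have N2: "int (q - 1) = 2 * N" unfolding N_def using q_mod_4 by presburger
  obtain i where i: "c = gp i" using gp(5) assms False by blast
  have c: "c [^] ((q - 1) div 2) = gp (i * N)"
    unfolding i N_def by (rule exponential_nat_pow[of gp, OF gp(1,3,4)])
  show ?thesis
  proof (cases "even i")
    case True
    then obtain j where "i = 2 * j" by auto
    then have "gp (i * N) = gp 0" unfolding gp(6) N2 by simp
    then show ?thesis using True c i gp(3,7) by (simp add: add_pow_int_ge)
  next
    case False
    then obtain j where "i = 2 * j + 1" by (auto elim: oddE)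
    then have "gp (i * N) = gp N" unfolding gp(6) N2 by (simp add: algebra_simps)
    then show ?thesis using False c i gp(7,8) by (simp add: add_pow_int_lt N_def)
  qed
qed

lemma sum_eta: "(\<Sum>c\<in>carrier F. eta c) = 0"
proof -
  have "bij_betw (\<lambda>c. \<ominus> c) (carrier F) (carrier F)"
    by (rule bij_betw_byWitness[where f' = "\<lambda>c. \<ominus> c"]) auto
  from sum.reindex_bij_betw[OF this, of eta]
  have "(\<Sum>c\<in>carrier F. eta c) = (\<Sum>c\<in>carrier F. - eta c)" by (simp add: eta_minus)
  then show ?thesis by (simp add: sum_negf)
qed

lemma sum_translate:
  fixes G :: "'a \<Rightarrow> int"
  assumes "x \<in> carrier F"
  shows "(\<Sum>c\<in>carrier F. G (c \<ominus> x)) = (\<Sum>c\<in>carrier F. G c)"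
proof -
  have "bij_betw (\<lambda>c. c \<ominus> x) (carrier F) (carrier F)"
    using assms by (intro bij_betw_byWitness[where f' = "\<lambda>c. c \<oplus> x"]) (auto simp: minus_eq a_assoc l_neg r_neg)
  from sum.reindex_bij_betw[OF this, of G] show ?thesis .
qed

text \<open>For nonzero c the summand is \<eta>(1 + d / c), and 1 + d / c takes every value except 1
  exactly once; so the sum is 0 - \<eta>(1).\<close>

lemma sum_eta_shift_product:
  assumes d: "d \<in> carrier F" "d \<noteq> \<zero>"
  shows "(\<Sum>c\<in>carrier F. eta c * eta (c \<oplus> d)) = - 1"
proof -
  have uni: "c \<in> Units F" if "c \<in> carrier F" "c \<noteq> \<zero>" for c using that field_Units by auto
  have "(\<Sum>c\<in>carrier F. eta c * eta (c \<oplus> d)) = (\<Sum>c\<in>carrier F - {\<zero>}. eta c * eta (c \<oplus> d))"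
    using finite_carrier by (simp add: sum.remove[of _ \<zero>])
  also have "\<dots> = (\<Sum>c\<in>carrier F - {\<zero>}. eta (\<one> \<oplus> d \<otimes> inv c))"
  proof (intro sum.cong refl)
    fix c assume "c \<in> carrier F - {\<zero>}"
    then have c: "c \<in> carrier F" "c \<noteq> \<zero>" "c \<in> Units F" "inv c \<in> carrier F" using uni by auto
    have "c \<otimes> (\<one> \<oplus> d \<otimes> inv c) = c \<oplus> d \<otimes> (c \<otimes> inv c)" using c d by algebra
    then have "c \<oplus> d = c \<otimes> (\<one> \<oplus> d \<otimes> inv c)" using c d by simp
    then have "eta c * eta (c \<oplus> d) = eta c * eta c * eta (\<one> \<oplus> d \<otimes> inv c)"
      using c d by (simp add: eta_mult)
    also have "eta c * eta c = 1" using c eta_range[of c] eta_eq_0_iff[of c] by auto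
    finally show "eta c * eta (c \<oplus> d) = eta (\<one> \<oplus> d \<otimes> inv c)" by simp
  qed
  also have "\<dots> = (\<Sum>c\<in>carrier F - {\<one>}. eta c)"
  proof (rule sum.reindex_bij_betw)
    let ?h = "\<lambda>c. \<one> \<oplus> d \<otimes> inv c"
    have dU: "d \<in> Units F" using d uni by auto
    have inj: "inj_on ?h (carrier F - {\<zero>})"
    proof (rule inj_onI)
      fix x y assume xy: "x \<in> carrier F - {\<zero>}" "y \<in> carrier F - {\<zero>}" and "?h x = ?h y"
      then have U: "x \<in> Units F" "y \<in> Units F" using uni by auto
      then have "d \<otimes> inv x = d \<otimes> inv y" using \<open>?h x = ?h y\<close> d by simp
      then have "inv x = inv y" using Units_l_cancel[OF dU] U by simp
      then show "x = y" using U by (metis Units_inv_inv)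
    qed
    have "?h ` (carrier F - {\<zero>}) \<subseteq> carrier F - {\<one>}"
    proof
      fix w assume "w \<in> ?h ` (carrier F - {\<zero>})"
      then obtain c where c: "c \<in> carrier F" "c \<noteq> \<zero>" "w = ?h c" by auto
      then have cU: "c \<in> Units F" using uni by auto
      have "w \<noteq> \<one>"
      proof
        assume "w = \<one>"
        then have "d \<otimes> inv c = \<zero>" using c d cU by (metis Units_inv_closed add.l_cancel_one' m_closed one_closed)
        then have "inv c = \<zero>" using d cU integral by blast
        then show False using Units_r_inv[OF cU] c by simp
      qed
      then show "w \<in> carrier F - {\<one>}" using c d cU by auto
    qed
    moreover have "card (?h ` (carrier F - {\<zero>})) = card (carrier F - {\<one>})"
      using card_image[OF inj] finite_carrier by simp
    ultimately have "?h ` (carrier F - {\<zero>}) = carrier F - {\<one>}"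
      using finite_carrier by (intro card_subset_eq) auto
    then show "bij_betw ?h (carrier F - {\<zero>}) (carrier F - {\<one>})" using inj by (simp add: bij_betw_def)
  qed
  also have "\<dots> = - 1" using sum_eta finite_carrier by (simp add: sum.remove[of _ \<one>])
  finally show ?thesis .
qed

end

section \<open>The quadratic extension\<close>

text \<open>F[X] / (X^2 + 1) as pairs, so that real and imaginary part are simply the
  projections.\<close>

definition gaussian_extension :: "('a, 'b) ring_scheme \<Rightarrow> ('a \<times> 'a) ring" where
  "gaussian_extension F = \<lparr>carrier = carrier F \<times> carrier F,
     monoid.mult = (\<lambda>(a, b) (c, d). (a \<otimes>\<^bsub>F\<^esub> c \<ominus>\<^bsub>F\<^esub> b \<otimes>\<^bsub>F\<^esub> d, a \<otimes>\<^bsub>F\<^esub> d \<oplus>\<^bsub>F\<^esub> b \<otimes>\<^bsub>F\<^esub> c)),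
     one = (\<one>\<^bsub>F\<^esub>, \<zero>\<^bsub>F\<^esub>), zero = (\<zero>\<^bsub>F\<^esub>, \<zero>\<^bsub>F\<^esub>),
     add = (\<lambda>(a, b) (c, d). (a \<oplus>\<^bsub>F\<^esub> c, b \<oplus>\<^bsub>F\<^esub> d))\<rparr>"

lemma gaussian_extension_simps [simp]:
  "carrier (gaussian_extension F) = carrier F \<times> carrier F"
  "(a, b) \<otimes>\<^bsub>gaussian_extension F\<^esub> (c, d) =
    (a \<otimes>\<^bsub>F\<^esub> c \<ominus>\<^bsub>F\<^esub> b \<otimes>\<^bsub>F\<^esub> d, a \<otimes>\<^bsub>F\<^esub> d \<oplus>\<^bsub>F\<^esub> b \<otimes>\<^bsub>F\<^esub> c)"
  "(a, b) \<oplus>\<^bsub>gaussian_extension F\<^esub> (c, d) = (a \<oplus>\<^bsub>F\<^esub> c, b \<oplus>\<^bsub>F\<^esub> d)"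
  "\<one>\<^bsub>gaussian_extension F\<^esub> = (\<one>\<^bsub>F\<^esub>, \<zero>\<^bsub>F\<^esub>)"
  "\<zero>\<^bsub>gaussian_extension F\<^esub> = (\<zero>\<^bsub>F\<^esub>, \<zero>\<^bsub>F\<^esub>)"
  by (simp_all add: gaussian_extension_def)

lemma (in cring) gaussian_extension_cring: "cring (gaussian_extension R)"
proof (intro cringI abelian_groupI comm_monoidI)
  fix x y z
  assume "x \<in> carrier (gaussian_extension R)" "y \<in> carrier (gaussian_extension R)"
    "z \<in> carrier (gaussian_extension R)"
  then obtain a b c d e f where [simp]: "x = (a, b)" "y = (c, d)" "z = (e, f)"
    and c: "a \<in> carrier R" "b \<in> carrier R" "c \<in> carrier R" "d \<in> carrier R" "e \<in> carrier R" "f \<in> carrier R"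
    by auto
  show "x \<oplus>\<^bsub>gaussian_extension R\<^esub> y \<oplus>\<^bsub>gaussian_extension R\<^esub> z =
      x \<oplus>\<^bsub>gaussian_extension R\<^esub> (y \<oplus>\<^bsub>gaussian_extension R\<^esub> z)"
    using c by (simp add: a_assoc)
  have "(a \<otimes> c \<ominus> b \<otimes> d) \<otimes> e \<ominus> (a \<otimes> d \<oplus> b \<otimes> c) \<otimes> f = a \<otimes> (c \<otimes> e \<ominus> d \<otimes> f) \<ominus> b \<otimes> (c \<otimes> f \<oplus> d \<otimes> e)"
    "(a \<otimes> c \<ominus> b \<otimes> d) \<otimes> f \<oplus> (a \<otimes> d \<oplus> b \<otimes> c) \<otimes> e = a \<otimes> (c \<otimes> f \<oplus> d \<otimes> e) \<oplus> b \<otimes> (c \<otimes> e \<ominus> d \<otimes> f)"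
    using c by algebra+
  then show "x \<otimes>\<^bsub>gaussian_extension R\<^esub> y \<otimes>\<^bsub>gaussian_extension R\<^esub> z =
      x \<otimes>\<^bsub>gaussian_extension R\<^esub> (y \<otimes>\<^bsub>gaussian_extension R\<^esub> z)"
    by simp
  have "(a \<oplus> c) \<otimes> e \<ominus> (b \<oplus> d) \<otimes> f = (a \<otimes> e \<ominus> b \<otimes> f) \<oplus> (c \<otimes> e \<ominus> d \<otimes> f)"
    "(a \<oplus> c) \<otimes> f \<oplus> (b \<oplus> d) \<otimes> e = (a \<otimes> f \<oplus> b \<otimes> e) \<oplus> (c \<otimes> f \<oplus> d \<otimes> e)"
    using c by algebra+
  then show "(x \<oplus>\<^bsub>gaussian_extension R\<^esub> y) \<otimes>\<^bsub>gaussian_extension R\<^esub> z =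
      x \<otimes>\<^bsub>gaussian_extension R\<^esub> z \<oplus>\<^bsub>gaussian_extension R\<^esub> y \<otimes>\<^bsub>gaussian_extension R\<^esub> z"
    by simp
next
  fix x y
  assume "x \<in> carrier (gaussian_extension R)" "y \<in> carrier (gaussian_extension R)"
  then obtain a b c d where [simp]: "x = (a, b)" "y = (c, d)"
    and c: "a \<in> carrier R" "b \<in> carrier R" "c \<in> carrier R" "d \<in> carrier R"
    by auto
  show "x \<oplus>\<^bsub>gaussian_extension R\<^esub> y = y \<oplus>\<^bsub>gaussian_extension R\<^esub> x"
    using c by (simp add: a_comm)
  show "x \<otimes>\<^bsub>gaussian_extension R\<^esub> y = y \<otimes>\<^bsub>gaussian_extension R\<^esub> x"
    using c by (simp add: m_comm a_comm)
  show "x \<oplus>\<^bsub>gaussian_extension R\<^esub> y \<in> carrier (gaussian_extension R)"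
    "x \<otimes>\<^bsub>gaussian_extension R\<^esub> y \<in> carrier (gaussian_extension R)"
    using c by auto
next
  fix x assume "x \<in> carrier (gaussian_extension R)"
  then obtain a b where [simp]: "x = (a, b)" and c: "a \<in> carrier R" "b \<in> carrier R" by auto
  show "\<zero>\<^bsub>gaussian_extension R\<^esub> \<oplus>\<^bsub>gaussian_extension R\<^esub> x = x"
    "\<one>\<^bsub>gaussian_extension R\<^esub> \<otimes>\<^bsub>gaussian_extension R\<^esub> x = x"
    using c by (auto simp: minus_eq)
  show "\<exists>y\<in>carrier (gaussian_extension R). y \<oplus>\<^bsub>gaussian_extension R\<^esub> x = \<zero>\<^bsub>gaussian_extension R\<^esub>"
    using c by (intro bexI[of _ "(\<ominus> a, \<ominus> b)"]) (auto simp: l_neg)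
qed auto

context finite_field_3_mod_4
begin

text \<open>Since \<eta> is 1 on nonzero squares and odd, a nonzero square is never minus a
  square.\<close>

lemma sum_of_two_squares_nonzero:
  assumes a: "a \<in> carrier F" and b: "b \<in> carrier F" and ab: "\<not> (a = \<zero> \<and> b = \<zero>)"
  shows "a \<otimes> a \<oplus> b \<otimes> b \<noteq> \<zero>"
proof
  assume 0: "a \<otimes> a \<oplus> b \<otimes> b = \<zero>"
  then have eq: "a \<otimes> a = \<ominus> (b \<otimes> b)" using a b minus_equality[of "a \<otimes> a" "b \<otimes> b"] by simp
  have sq: "eta (x \<otimes> x) = 1" if "x \<in> carrier F" "x \<noteq> \<zero>" for x
    using that eta_mult[of x x] eta_range[of x] eta_eq_0_iff[of x] by auto
  show False
  proof (cases "b = \<zero>")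
    case True
    then have "a \<otimes> a = \<zero>" using eq by simp
    then show False using ab True a integral by auto
  next
    case False
    then have "eta (a \<otimes> a) = - 1" unfolding eq using b sq[of b] by (simp add: eta_minus)
    then show False using a sq[of a] by (cases "a = \<zero>") auto
  qed
qed

sublocale K: field "gaussian_extension F"
proof (rule cring.cring_fieldI2[OF gaussian_extension_cring])
  show "\<zero>\<^bsub>gaussian_extension F\<^esub> \<noteq> \<one>\<^bsub>gaussian_extension F\<^esub>" by simp
  fix x assume "x \<in> carrier (gaussian_extension F)" "x \<noteq> \<zero>\<^bsub>gaussian_extension F\<^esub>"
  then obtain a b where x: "x = (a, b)" and c: "a \<in> carrier F" "b \<in> carrier F" "\<not> (a = \<zero> \<and> b = \<zero>)" by auto
  \<comment> \<open>N is the norm of x; the inverse of x is its conjugate divided by N.\<close>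
  define N where "N = a \<otimes> a \<oplus> b \<otimes> b"
  have N: "N \<in> carrier F" "N \<noteq> \<zero>" using c sum_of_two_squares_nonzero by (auto simp: N_def)
  then have U: "N \<in> Units F" "inv N \<in> carrier F" using field_Units by auto
  have "a \<otimes> (a \<otimes> inv N) \<ominus> b \<otimes> (\<ominus> b \<otimes> inv N) = N \<otimes> inv N"
    "a \<otimes> (\<ominus> b \<otimes> inv N) \<oplus> b \<otimes> (a \<otimes> inv N) = \<zero>"
    unfolding N_def using c U(2)[unfolded N_def] by algebra+
  then have "x \<otimes>\<^bsub>gaussian_extension F\<^esub> (a \<otimes> inv N, \<ominus> b \<otimes> inv N) = \<one>\<^bsub>gaussian_extension F\<^esub>"
    using U by (simp add: x)
  then show "\<exists>y\<in>carrier (gaussian_extension F). x \<otimes>\<^bsub>gaussian_extension F\<^esub> y = \<one>\<^bsub>gaussian_extension F\<^esub>"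
    using c U by (intro bexI[of _ "(a \<otimes> inv N, \<ominus> b \<otimes> inv N)"]) auto
qed

abbreviation "K \<equiv> gaussian_extension F"

lemma card_K: "card (carrier K) = q * q"
  by (simp add: card_cartesian_product card_carrier)

definition cj :: "'a \<times> 'a \<Rightarrow> 'a \<times> 'a" where
  "cj z = (fst z, \<ominus> snd z)"

definition norm :: "'a \<times> 'a \<Rightarrow> 'a" where
  "norm z = fst z \<otimes> fst z \<oplus> snd z \<otimes> snd z"

lemma cj_closed [simp]: "z \<in> carrier K \<Longrightarrow> cj z \<in> carrier K"
  by (auto simp: cj_def)

lemma norm_closed [simp]: "z \<in> carrier K \<Longrightarrow> norm z \<in> carrier F"
  by (auto simp: norm_def)

lemma cj_times_self: "z \<in> carrier K \<Longrightarrow> cj z \<otimes>\<^bsub>K\<^esub> z = (norm z, \<zero>)"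
proof -
  assume "z \<in> carrier K"
  then obtain a b where z: "z = (a, b)" and c: "a \<in> carrier F" "b \<in> carrier F" by auto
  have "a \<otimes> a \<ominus> \<ominus> b \<otimes> b = a \<otimes> a \<oplus> b \<otimes> b" "a \<otimes> b \<oplus> \<ominus> b \<otimes> a = \<zero>" using c by algebra+
  then show ?thesis by (simp add: z cj_def norm_def)
qed

lemma norm_mult: "z \<in> carrier K \<Longrightarrow> w \<in> carrier K \<Longrightarrow> norm (z \<otimes>\<^bsub>K\<^esub> w) = norm z \<otimes> norm w"
proof -
  assume "z \<in> carrier K" "w \<in> carrier K"
  then obtain a b c d where z: "z = (a, b)" "w = (c, d)"
    and c: "a \<in> carrier F" "b \<in> carrier F" "c \<in> carrier F" "d \<in> carrier F" by auto
  have "(a \<otimes> c \<ominus> b \<otimes> d) \<otimes> (a \<otimes> c \<ominus> b \<otimes> d) \<oplus> (a \<otimes> d \<oplus> b \<otimes> c) \<otimes> (a \<otimes> d \<oplus> b \<otimes> c) =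
      (a \<otimes> a \<oplus> b \<otimes> b) \<otimes> (c \<otimes> c \<oplus> d \<otimes> d)" using c by algebra
  then show ?thesis by (simp add: z norm_def)
qed

lemma scalar_pow: "x \<in> carrier F \<Longrightarrow> (x, \<zero>) [^]\<^bsub>K\<^esub> (n::nat) = (x [^] n, \<zero>)"
  by (induction n) (auto simp: minus_eq)

lemma pow_card_minus_one:
  assumes "x \<in> carrier F" "x \<noteq> \<zero>"
  shows "x [^] (q - 1) = \<one>"
proof -
  obtain gp :: "int \<Rightarrow> 'a" where gp: "\<And>i. gp i \<in> carrier F" "\<And>i. gp i \<noteq> \<zero>" "gp 0 = \<one>"
    "\<And>i j. gp (i + j) = gp i \<otimes> gp j"
    "\<And>x. x \<in> carrier F \<Longrightarrow> x \<noteq> \<zero> \<Longrightarrow> \<exists>i. x = gp i"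
    "\<And>i j. gp i = gp j \<longleftrightarrow> int (q - 1) dvd i - j"
    "\<And>i. eta (gp i) = (if even i then 1 else - 1)"
    "gp (int ((q - 1) div 2)) = \<ominus> \<one>"
    by (fact eta_euler_exponential)
  obtain i where i: "x = gp i" using gp(5) assms by blast
  have "x [^] (q - 1) = gp (i * int (q - 1))"
    unfolding i by (rule exponential_nat_pow[of gp, OF gp(1,3,4)])
  also have "\<dots> = gp 0" unfolding gp(6) by simp
  finally show ?thesis by (simp add: gp(3))
qed

lemma exists_gaussian_exponential:
  obtains gp :: "int \<Rightarrow> 'a \<times> 'a" where "\<And>i. gp i \<in> carrier K" "\<And>i. gp i \<noteq> \<zero>\<^bsub>K\<^esub>" "gp 0 = \<one>\<^bsub>K\<^esub>"
    "\<And>i j. gp (i + j) = gp i \<otimes>\<^bsub>K\<^esub> gp j"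
    "\<And>x. x \<in> carrier K \<Longrightarrow> x \<noteq> \<zero>\<^bsub>K\<^esub> \<Longrightarrow> \<exists>i. x = gp i"
    "\<And>i j. gp i = gp j \<longleftrightarrow> (int q - 1) * (int q + 1) dvd i - j"
proof -
  have fin: "finite (carrier K)" using finite_carrier by simp
  have card: "int (card (carrier K) - 1) = (int q - 1) * (int q + 1)"
    unfolding card_K using q_ge_3 by (simp add: algebra_simps of_nat_diff)
  show ?thesis
    by (rule K.finite_field_exponential[OF fin, unfolded card]) (rule that)
qed

end

section \<open>Exponents of a generator of the multiplicative group of K\<close>

locale gaussian_exponential = finite_field_3_mod_4 F q for F (structure) and q +
  fixes gp :: "int \<Rightarrow> 'a \<times> 'a"
  assumes gp_closed: "gp i \<in> carrier K"
    and gp_nonzero: "gp i \<noteq> \<zero>\<^bsub>K\<^esub>"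
    and gp_0: "gp 0 = \<one>\<^bsub>K\<^esub>"
    and gp_add: "gp (i + j) = gp i \<otimes>\<^bsub>K\<^esub> gp j"
    and gp_surj: "x \<in> carrier K \<Longrightarrow> x \<noteq> \<zero>\<^bsub>K\<^esub> \<Longrightarrow> \<exists>i. x = gp i"
    and gp_eq_iff: "gp i = gp j \<longleftrightarrow> (int q - 1) * (int q + 1) dvd i - j"
begin

lemma fst_gp_closed [simp]: "fst (gp i) \<in> carrier F"
  and snd_gp_closed [simp]: "snd (gp i) \<in> carrier F"
  using gp_closed[of i] by auto

lemma gp_pow: "gp i [^]\<^bsub>K\<^esub> (n::nat) = gp (i * int n)"
  by (rule K.exponential_nat_pow[of gp, OF gp_closed gp_0 gp_add])

lemma gp_nat_rep: obtains n :: nat where "gp i = gp (int n)"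
proof (rule that)
  have "(int q - 1) * (int q + 1) > 0" using q_ge_3 by simp
  then show "gp i = gp (int (nat (i mod ((int q - 1) * (int q + 1)))))"
    unfolding gp_eq_iff by (simp add: minus_mod_eq_mult_div)
qed

text \<open>From x^(q-1) = 1 it follows that (q - 1) (q + 1) divides (q - 1) i, where i is the
  exponent of x.\<close>

lemma scalar_eq_gp:
  assumes "x \<in> carrier F" "x \<noteq> \<zero>"
  obtains s where "(x, \<zero>) = gp ((int q + 1) * s)"
proof -
  have x: "(x, \<zero>) \<in> carrier K" "(x, \<zero>) \<noteq> \<zero>\<^bsub>K\<^esub>" using assms by auto
  obtain i where i: "(x, \<zero>) = gp i" using gp_surj[OF x] by blast
  have "gp (i * int (q - 1)) = gp 0"
    using scalar_pow[OF assms(1), of "q - 1"] pow_card_minus_one[OF assms] unfolding i gp_pow gp_0 by simp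
  then have "(int q - 1) * (int q + 1) dvd (int q - 1) * i"
    unfolding gp_eq_iff using q_ge_3 by (simp add: of_nat_diff mult.commute)
  then have "int q + 1 dvd i" using q_ge_3 by simp
  then obtain s where "i = (int q + 1) * s" by blast
  then show ?thesis using that i by simp
qed

text \<open>The converse of \<open>scalar_eq_gp\<close>, by counting: the q - 1 nonzero scalars are
  among the at most q - 1 powers of g^(q+1), so each of these powers is a scalar.\<close>

lemma snd_gp_multiple: "snd (gp ((int q + 1) * s)) = \<zero>"
proof -
  let ?A = "(\<lambda>x. (x, \<zero>)) ` (carrier F - {\<zero>})" and ?B = "(\<lambda>s. gp ((int q + 1) * int s)) ` {..<q - 1}"
  have q1: "int (q - 1) = int q - 1" "int q - 1 > 0" using q_ge_3 by simp_all
  have B: "gp ((int q + 1) * s) \<in> ?B" for s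
  proof (rule image_eqI)
    have "(int q - 1) * (int q + 1) dvd (int q + 1) * (s - s mod (int q - 1))"
      by (simp add: minus_mod_eq_mult_div)
    then show "gp ((int q + 1) * s) = gp ((int q + 1) * int (nat (s mod (int q - 1))))"
      unfolding gp_eq_iff using q1 by (simp add: right_diff_distrib)
    have "s mod (int q - 1) < int (q - 1)" using q1 by simp
    then show "nat (s mod (int q - 1)) \<in> {..<q - 1}" using q1 by (simp add: nat_less_iff)
  qed
  have "?A \<subseteq> ?B"
  proof
    fix z assume "z \<in> ?A"
    then obtain x where "x \<in> carrier F" "x \<noteq> \<zero>" "z = (x, \<zero>)" by auto
    then show "z \<in> ?B" using scalar_eq_gp[of x] B by metis
  qed
  moreover have "card ?B \<le> card ?A"
  proof -
    have "card ?B \<le> q - 1" using card_image_le[of "{..<q - 1}"] by simp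
    also have "q - 1 = card ?A" using finite_carrier card_carrier
      by (subst card_image) (auto simp: inj_on_def)
    finally show ?thesis .
  qed
  ultimately have "?A = ?B" by (intro card_seteq) auto
  then have "gp ((int q + 1) * s) \<in> ?A" using B[of s] by (simp only:)
  then show ?thesis by auto
qed

definition c0 :: 'a where "c0 = fst (gp (int q + 1))"

lemma c0: "gp (int q + 1) = (c0, \<zero>)" "c0 \<in> carrier F" "c0 \<noteq> \<zero>"
proof -
  show "gp (int q + 1) = (c0, \<zero>)" using snd_gp_multiple[of 1] by (simp add: c0_def prod_eq_iff)
  then show "c0 \<noteq> \<zero>" using gp_nonzero[of "int q + 1"] by auto
  show "c0 \<in> carrier F" by (simp add: c0_def)
qed

text \<open>A square root of \<open>c0\<close> in F would be some g^((q+1) s), and then the even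
  number q - 1 would divide 1 - 2 s.\<close>

lemma eta_c0: "eta c0 = - 1"
proof -
  have "\<not> is_square c0"
  proof
    assume "is_square c0"
    then obtain y where y: "y \<in> carrier F" "c0 = y \<otimes> y" by (auto simp: is_square_def)
    then have "y \<noteq> \<zero>" using c0 by auto
    then obtain s where s: "(y, \<zero>) = gp ((int q + 1) * s)" using scalar_eq_gp y by blast
    have "gp (int q + 1) = (y, \<zero>) \<otimes>\<^bsub>K\<^esub> (y, \<zero>)" using y c0 by (simp add: minus_eq)
    also have "\<dots> = gp ((int q + 1) * s + (int q + 1) * s)" unfolding s gp_add ..
    finally have "(int q - 1) * (int q + 1) dvd (int q + 1) - ((int q + 1) * s + (int q + 1) * s)"
      unfolding gp_eq_iff .
    then have "(int q + 1) * (int q - 1) dvd (int q + 1) * (1 - 2 * s)" by (simp add: algebra_simps)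
    then have "int q - 1 dvd 1 - 2 * s" by (simp only: dvd_mult_cancel_left) simp
    moreover have "even (int q - 1)" using q_mod_4 by presburger
    ultimately have "even (1 - 2 * s)" by (rule dvd_trans[rotated])
    then show False by simp
  qed
  then show ?thesis using c0 by (simp add: eta_def)
qed

lemma step_by_scalar:
  "fst (gp (i + (int q + 1))) = fst (gp i) \<otimes> c0"
  "snd (gp (i + (int q + 1))) = snd (gp i) \<otimes> c0"
proof -
  obtain a b where ab: "gp i = (a, b)" "a \<in> carrier F" "b \<in> carrier F" using gp_closed[of i] by auto
  have "gp (i + (int q + 1)) = (a \<otimes> c0, b \<otimes> c0)"
    unfolding gp_add[of i "int q + 1"] c0(1) ab(1) using ab c0(2) by (simp add: minus_eq)
  then show "fst (gp (i + (int q + 1))) = fst (gp i) \<otimes> c0" "snd (gp (i + (int q + 1))) = snd (gp i) \<otimes> c0"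
    using ab(1) by simp_all
qed

definition phi :: "int \<Rightarrow> int" where "phi i = eta (snd (gp i))"

lemma phi_antiperiodic: "phi (i + (int q + 1)) = - phi i"
  unfolding phi_def step_by_scalar using c0(2) by (simp add: eta_mult eta_c0)

lemma phi_shift: "phi (i + (int q + 1) * z) = parity_sign z * phi i"
proof -
  have "phi (i + (int q + 1) * (z + 1)) = - phi (i + (int q + 1) * z)" for z
    using phi_antiperiodic[of "i + (int q + 1) * z"] by (simp add: algebra_simps)
  from alternating_parity_sign[of "\<lambda>z. phi (i + (int q + 1) * z)", OF this] show ?thesis by simp
qed

lemma eta_fst_gp_multiple: "eta (fst (gp ((int q + 1) * s))) = parity_sign s"
proof -
  have "eta (fst (gp ((int q + 1) * (z + 1)))) = - eta (fst (gp ((int q + 1) * z)))" for z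
    using step_by_scalar(1)[of "(int q + 1) * z"] c0(2) by (simp add: eta_mult eta_c0 algebra_simps)
  from alternating_parity_sign[of "\<lambda>z. eta (fst (gp ((int q + 1) * z)))", OF this]
  show ?thesis by (simp add: gp_0)
qed

lemma norm_gp_nat: "norm (gp (int n)) = norm (gp 1) [^] n"
proof (induction n)
  case 0
  then show ?case by (simp add: gp_0 norm_def)
next
  case (Suc n)
  have "gp (int (Suc n)) = gp (int n) \<otimes>\<^bsub>K\<^esub> gp 1" by (simp add: add.commute flip: gp_add)
  then show ?case using Suc norm_mult[OF gp_closed gp_closed] by simp
qed

text \<open>Otherwise all sums of two squares would be squares, and hence so would \<open>- 1 = 1 + \<dots> + 1\<close>.\<close>
lemma eta_norm_generator: "eta (norm (gp 1)) = - 1"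
proof (rule ccontr)
  assume neg: "eta (norm (gp 1)) \<noteq> - 1"
  have nz: "norm z \<noteq> \<zero>" if "z \<in> carrier K" "z \<noteq> \<zero>\<^bsub>K\<^esub>" for z
  proof -
    obtain a b where "z = (a, b)" "a \<in> carrier F" "b \<in> carrier F" "\<not> (a = \<zero> \<and> b = \<zero>)"
      using \<open>z \<in> carrier K\<close> \<open>z \<noteq> \<zero>\<^bsub>K\<^esub>\<close> by auto
    then show ?thesis using sum_of_two_squares_nonzero[of a b] by (simp add: norm_def)
  qed
  have "eta (norm (gp 1)) = 1"
    using neg eta_range[of "norm (gp 1)"] nz[OF gp_closed gp_nonzero] eta_eq_0_iff by blast
  then have pw: "eta (norm (gp 1) [^] (n::nat)) = 1" for n
    using gp_closed[of 1] by (induction n) (simp_all add: eta_mult norm_def)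
  have sums: "eta (a \<otimes> a \<oplus> b \<otimes> b) = 1" if "a \<in> carrier F" "b \<in> carrier F" "b \<noteq> \<zero>" for a b
  proof -
    have ab: "(a, b) \<in> carrier K" "(a, b) \<noteq> \<zero>\<^bsub>K\<^esub>" using that by auto
    obtain i where "(a, b) = gp i" using gp_surj[OF ab] by blast
    then obtain n where "(a, b) = gp (int n)" using gp_nat_rep[of i] by metis
    then have "eta (norm (a, b)) = 1" using pw norm_gp_nat by simp
    then show ?thesis by (simp add: norm_def)
  qed
  have mult: "[n] \<cdot> \<one> = \<zero> \<or> eta ([n] \<cdot> \<one>) = 1" for n :: nat
  proof (induction n)
    case (Suc n)
    show ?case
    proof (cases "[n] \<cdot> \<one> = \<zero>")
      case False
      then have "is_square ([n] \<cdot> \<one>)" using Suc by (auto simp: eta_def split: if_splits)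
      then obtain y where "y \<in> carrier F" "[n] \<cdot> \<one> = y \<otimes> y" by (auto simp: is_square_def)
      then show ?thesis using sums[of y \<one>] by simp
    qed simp
  qed simp
  obtain r where r: "q = Suc r" using q_ge_3 by (cases q) auto
  have "[r] \<cdot> \<one> \<oplus> \<one> = \<zero>" using add_pow_q r by simp
  then have "[r] \<cdot> \<one> = \<ominus> \<one>" using minus_equality[of "[r] \<cdot> \<one>" \<one>] by simp
  then show False using mult[of r] eta_minus_one eta_eq_0_iff[of "\<ominus> \<one>"] by simp
qed

text \<open>That the norm of g is g^(q+1), obtained without the Frobenius map. The norm of g is a
  scalar g^((q+1) s). The scalar g^(q+1) has its own square as norm, which gives s = 1 modulo (q -
  1) / 2. As (q - 1) / 2 is odd, and s is odd by \<open>eta_norm_generator\<close>, s = 1 modulo q -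
  1.\<close>

lemma norm_gp: "(norm (gp (int n)), \<zero>) = gp ((int q + 1) * int n)"
proof -
  have n1: "norm (gp 1) \<in> carrier F" "norm (gp 1) \<noteq> \<zero>"
    using eta_norm_generator gp_closed[of 1] by (auto simp: norm_def)
  obtain s where s: "(norm (gp 1), \<zero>) = gp ((int q + 1) * s)" using scalar_eq_gp[OF n1] by blast
  have pw: "(norm (gp (int n)), \<zero>) = gp ((int q + 1) * s * int n)" for n
    using scalar_pow[OF n1(1), of n] unfolding norm_gp_nat s gp_pow by simp
  have "parity_sign s = - 1"
    using eta_norm_generator eta_fst_gp_multiple[of s] unfolding s[symmetric] by simp
  then have "odd s" by (auto simp: parity_sign_def split: if_splits)
  have "(norm (gp (int (q + 1))), \<zero>) = (c0 \<otimes> c0, \<zero>)"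
    using c0 by (simp add: norm_def add.commute)
  also have "\<dots> = gp (int q + 1) \<otimes>\<^bsub>K\<^esub> gp (int q + 1)" unfolding c0(1) using c0 by (simp add: minus_eq)
  also have "\<dots> = gp ((int q + 1) + (int q + 1))" by (rule gp_add[symmetric])
  finally have "(int q - 1) * (int q + 1) dvd (int q + 1) * s * int (q + 1) - ((int q + 1) + (int q + 1))"
    unfolding pw gp_eq_iff .
  then have "(int q + 1) * (int q - 1) dvd (int q + 1) * (s * (int q - 1) + 2 * (s - 1))"
    by (simp add: algebra_simps)
  then have "int q - 1 dvd s * (int q - 1) + 2 * (s - 1)" by (simp only: dvd_mult_cancel_left) simp
  then have d: "int q - 1 dvd 2 * (s - 1)" by (simp add: dvd_add_right_iff)
  define h where "h = (int q - 1) div 2"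
  have h: "int q - 1 = 2 * h" "odd h" unfolding h_def using q_mod_4 by presburger+
  have "h dvd s - 1" using d unfolding h(1) by (simp only: dvd_mult_cancel_left) simp
  then obtain z where z: "s - 1 = h * z" by blast
  have "even (h * z)" using \<open>odd s\<close> unfolding z[symmetric] by simp
  then obtain u where "z = 2 * u" using h(2) by auto
  then have u: "s - 1 = (int q - 1) * u" unfolding h(1) z by simp
  have "(int q + 1) * s * int n - (int q + 1) * int n = (int q + 1) * (s - 1) * int n"
    by (simp add: algebra_simps)
  also have "\<dots> = (int q - 1) * (int q + 1) * (u * int n)" unfolding u by (simp add: algebra_simps)
  finally show ?thesis unfolding pw gp_eq_iff by simp
qed

text \<open>For z = g^n, the product of cj z and z is the norm g^((q+1) n); now cancel z.\<close>

lemma cj_gp: "cj (gp i) = gp (int q * i)"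
proof -
  have nat: "cj (gp (int n)) = gp (int q * int n)" for n
  proof -
    have "cj (gp (int n)) \<otimes>\<^bsub>K\<^esub> gp (int n) = gp ((int q + 1) * int n)"
      unfolding norm_gp[symmetric] by (rule cj_times_self[OF gp_closed])
    also have "(int q + 1) * int n = int q * int n + int n" by (simp add: algebra_simps)
    finally have "cj (gp (int n)) \<otimes>\<^bsub>K\<^esub> gp (int n) = gp (int q * int n) \<otimes>\<^bsub>K\<^esub> gp (int n)"
      unfolding gp_add .
    then show ?thesis
      using K.m_rcancel[OF gp_nonzero gp_closed cj_closed[OF gp_closed] gp_closed] by blast
  qed
  obtain n where n: "gp i = gp (int n)" by (rule gp_nat_rep)
  then have "(int q - 1) * (int q + 1) dvd int q * i - int q * int n"
    unfolding gp_eq_iff by (simp flip: right_diff_distrib)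
  then have "gp (int q * i) = gp (int q * int n)" unfolding gp_eq_iff .
  then show ?thesis using nat n by simp
qed

text \<open>The exponent q i of the conjugate is - i + (q + 1) i, and the shift by (q + 1) i
  accounts for the parity sign.\<close>

lemma phi_reflect: "phi (- i) = - parity_sign i * phi i"
proof -
  have "phi (- i + (int q + 1) * i) = phi (int q * i)" by (simp add: algebra_simps)
  also have "\<dots> = - phi i" unfolding phi_def cj_gp[symmetric] by (simp add: cj_def eta_minus)
  finally have "parity_sign i * phi (- i) = - phi i" unfolding phi_shift .
  then show ?thesis by (auto simp: parity_sign_def split: if_splits)
qed

text \<open>The exponent q i + j of the product is j - i + (q + 1) i. This is the formula for S
  required in \<open>paley_type\<close>.\<close>

lemma eta_snd_cj_times:
  "eta (snd (cj (gp i) \<otimes>\<^bsub>K\<^esub> gp j)) = parity_sign i * phi (j - i)"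
proof -
  have "cj (gp i) \<otimes>\<^bsub>K\<^esub> gp j = gp (j - i + (int q + 1) * i)"
    unfolding cj_gp gp_add[symmetric] by (simp add: algebra_simps)
  then have "eta (snd (cj (gp i) \<otimes>\<^bsub>K\<^esub> gp j)) = phi (j - i + (int q + 1) * i)" by (simp add: phi_def)
  then show ?thesis by (simp add: phi_shift)
qed

lemma phi_reflective_antiperiodic:
  assumes "q + 1 = 4 * t" "odd t"
  shows "reflective_antiperiodic phi t"
proof
  have "int q + 1 = 4 * int t" using assms(1) by linarith
  then show "phi (i + 4 * int t) = - phi i" for i using phi_antiperiodic[of i] by simp
  show "odd t" by fact
  show "phi (- i) = - parity_sign i * phi i" for i by (rule phi_reflect)
qed

end

section \<open>Reduction modulo the characteristic\<close>

lemma (in domain) add_pow_prime_power_zero: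
  assumes "[(p ^ n :: nat)] \<cdot> \<one> = \<zero>"
  shows "[p] \<cdot> \<one> = \<zero>"
  using assms
proof (induction n)
  case (Suc n)
  have "[(p ^ Suc n)] \<cdot> \<one> = [(p ^ n)] \<cdot> ([p] \<cdot> \<one>)" by (simp add: add.nat_pow_pow)
  also have "\<dots> = ([(p ^ n)] \<cdot> \<one>) \<otimes> ([p] \<cdot> \<one>)" by (subst add_pow_ldistr) auto
  finally have "([(p ^ n)] \<cdot> \<one>) \<otimes> ([p] \<cdot> \<one>) = \<zero>" using Suc.prems by simp
  then have "[(p ^ n)] \<cdot> \<one> = \<zero> \<or> [p] \<cdot> \<one> = \<zero>" by (intro integral) auto
  then show ?case using Suc.IH by blast
qed simp

lemma (in ring) add_pow_int_dvd:
  assumes "[(p::nat)] \<cdot> \<one> = \<zero>" "int p dvd z" "x \<in> carrier R"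
  shows "[z] \<cdot> x = \<zero>"
proof -
  obtain u where u: "z = int p * u" using assms(2) by blast
  have "[z] \<cdot> x = [z] \<cdot> (\<one> \<otimes> x)" using assms(3) by simp
  also have "\<dots> = ([z] \<cdot> \<one>) \<otimes> x" using assms(3) by (simp add: add_pow_ldistr_int)
  also have "[z] \<cdot> \<one> = [u] \<cdot> ([(int p)] \<cdot> \<one>)" unfolding u by (simp add: add.int_pow_pow)
  also have "[(int p)] \<cdot> \<one> = \<zero>" using assms(1) by (simp add: add_pow_int_ge)
  finally show ?thesis using assms(3) by simp
qed

lemma (in abelian_monoid) finsum_lessThan_Suc:
  assumes "f \<in> {..<Suc n} \<rightarrow> carrier G"
  shows "(\<Oplus>i\<in>{..<Suc n}. f i) = f n \<oplus> (\<Oplus>i\<in>{..<n}. f i)"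
proof -
  have "f \<in> {..<n} \<rightarrow> carrier G" "f n \<in> carrier G" using assms by (auto simp: Pi_iff less_Suc_eq)
  then show ?thesis by (simp add: lessThan_Suc)
qed

text \<open>The counterpart of \<open>correlation_eq\<close> for ring-valued h: folding the sum
  modulo 4 brings in the same alternating sums.\<close>

lemma (in ring) finsum_antiperiodic:
  fixes a :: "nat \<Rightarrow> int"
  assumes h: "\<And>i. h i \<in> carrier R" and anti: "\<And>i. h (i + 4) = \<ominus> h i"
  shows "(\<Oplus>i\<in>{..<4 * t}. [(a i)] \<cdot> h i) =
    [(\<Sum>j<t. parity_sign (int j) * a (4 * j))] \<cdot> h 0 \<oplus>
    [(\<Sum>j<t. parity_sign (int j) * a (4 * j + 1))] \<cdot> h 1 \<oplus>
    [(\<Sum>j<t. parity_sign (int j) * a (4 * j + 2))] \<cdot> h 2 \<oplus>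
    [(\<Sum>j<t. parity_sign (int j) * a (4 * j + 3))] \<cdot> h 3"
proof (induction t)
  case 0
  then show ?case by (simp add: add_pow_int_ge)
next
  case (Suc t)
  have blk: "h (4 * j + r) = [(parity_sign (int j))] \<cdot> h r" for j r
  proof (induction j)
    case 0
    then show ?case using h by (simp add: parity_sign_def add_pow_int_ge)
  next
    case (Suc j)
    have "h (4 * Suc j + r) = \<ominus> h (4 * j + r)" using anti[of "4 * j + r"] by (simp add: algebra_simps)
    also have "\<dots> = \<ominus> ([(parity_sign (int j))] \<cdot> h r)" by (simp only: Suc)
    also have "\<dots> = [(parity_sign (int (Suc j)))] \<cdot> h r"
      using h[of r] by (simp add: parity_sign_def add_pow_int_ge add_pow_int_lt)
    finally show ?case .
  qed
  have tm: "[(a (4 * t + r))] \<cdot> h (4 * t + r) = [(parity_sign (int t) * a (4 * t + r))] \<cdot> h r" for r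
    unfolding blk using h by (simp add: add.int_pow_pow mult.commute)
  have split: "[(\<Sum>j<Suc t. parity_sign (int j) * a (4 * j + r))] \<cdot> h r =
      [(\<Sum>j<t. parity_sign (int j) * a (4 * j + r))] \<cdot> h r \<oplus> [(a (4 * t + r))] \<cdot> h (4 * t + r)" for r
    unfolding tm using h by (simp add: add.int_pow_mult)
  have cl: "(\<lambda>i. [(a i)] \<cdot> h i) \<in> A \<rightarrow> carrier R" for A using h by auto
  have "4 * Suc t = Suc (Suc (Suc (Suc (4 * t))))" by simp
  then have "(\<Oplus>i\<in>{..<4 * Suc t}. [(a i)] \<cdot> h i) =
      [(a (4 * t + 3))] \<cdot> h (4 * t + 3) \<oplus> ([(a (4 * t + 2))] \<cdot> h (4 * t + 2) \<oplus>
      ([(a (4 * t + 1))] \<cdot> h (4 * t + 1) \<oplus> ([(a (4 * t + 0))] \<cdot> h (4 * t + 0) \<oplus> (\<Oplus>i\<in>{..<4 * t}. [(a i)] \<cdot> h i))))"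
    by (simp only: finsum_lessThan_Suc[OF cl]) (simp add: eval_nat_numeral)
  also have "(\<Oplus>i\<in>{..<4 * t}. [(a i)] \<cdot> h i) =
    [(\<Sum>j<t. parity_sign (int j) * a (4 * j + 0))] \<cdot> h 0 \<oplus>
    [(\<Sum>j<t. parity_sign (int j) * a (4 * j + 1))] \<cdot> h 1 \<oplus>
    [(\<Sum>j<t. parity_sign (int j) * a (4 * j + 2))] \<cdot> h 2 \<oplus>
    [(\<Sum>j<t. parity_sign (int j) * a (4 * j + 3))] \<cdot> h 3" using Suc by simp
  also have "[(a (4 * t + 3))] \<cdot> h (4 * t + 3) \<oplus> ([(a (4 * t + 2))] \<cdot> h (4 * t + 2) \<oplus>
      ([(a (4 * t + 1))] \<cdot> h (4 * t + 1) \<oplus> ([(a (4 * t + 0))] \<cdot> h (4 * t + 0) \<oplus> \<dots>))) =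
    [(\<Sum>j<Suc t. parity_sign (int j) * a (4 * j + 0))] \<cdot> h 0 \<oplus>
    [(\<Sum>j<Suc t. parity_sign (int j) * a (4 * j + 1))] \<cdot> h 1 \<oplus>
    [(\<Sum>j<Suc t. parity_sign (int j) * a (4 * j + 2))] \<cdot> h 2 \<oplus>
    [(\<Sum>j<Suc t. parity_sign (int j) * a (4 * j + 3))] \<cdot> h 3"
  proof -
    have rearrange: "x3 \<oplus> (x2 \<oplus> (x1 \<oplus> (x0 \<oplus> (y0 \<oplus> y1 \<oplus> y2 \<oplus> y3)))) =
        (y0 \<oplus> x0) \<oplus> (y1 \<oplus> x1) \<oplus> (y2 \<oplus> x2) \<oplus> (y3 \<oplus> x3)"
      if "x0 \<in> carrier R" "x1 \<in> carrier R" "x2 \<in> carrier R" "x3 \<in> carrier R"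
        "y0 \<in> carrier R" "y1 \<in> carrier R" "y2 \<in> carrier R" "y3 \<in> carrier R" for x0 x1 x2 x3 y0 y1 y2 y3
      using that by (simp add: a_ac)
    show ?thesis unfolding split using h by (intro rearrange) auto
  qed
  finally show ?case by simp
qed

lemma (in cring) finsum_geometric:
  assumes "y \<in> carrier R"
  shows "(\<Oplus>i\<in>{..<n::nat}. y [^] i) \<otimes> (y \<ominus> \<one>) = y [^] n \<ominus> \<one>"
proof (induction n)
  case 0
  then show ?case using assms by (simp add: minus_eq r_neg)
next
  case (Suc n)
  have c: "(\<Oplus>i\<in>{..<n}. y [^] i) \<in> carrier R" "y [^] n \<in> carrier R" using assms by auto
  have "(\<Oplus>i\<in>{..<Suc n}. y [^] i) \<otimes> (y \<ominus> \<one>) = (y [^] n \<oplus> (\<Oplus>i\<in>{..<n}. y [^] i)) \<otimes> (y \<ominus> \<one>)"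
    using assms by (subst finsum_lessThan_Suc) auto
  also have "\<dots> = y [^] n \<otimes> (y \<ominus> \<one>) \<oplus> (y [^] n \<ominus> \<one>)"
    using c assms by (simp add: l_distr Suc.IH)
  also have "\<dots> = y [^] n \<otimes> y \<ominus> \<one>" using c(2) assms by algebra
  finally show ?case by simp
qed

section \<open>A root-of-unity filter in K\<close>

context gaussian_exponential
begin

lemma K_minus: "a \<in> carrier F \<Longrightarrow> b \<in> carrier F \<Longrightarrow> \<ominus>\<^bsub>K\<^esub> (a, b) = (\<ominus> a, \<ominus> b)"
  by (rule K.minus_equality) (auto simp: l_neg)

lemma phi_euler: "[(phi i)] \<cdot>\<^bsub>K\<^esub> \<one>\<^bsub>K\<^esub> = (snd (gp i), \<zero>) [^]\<^bsub>K\<^esub> ((q - 1) div 2)"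
proof -
  have "[(phi i)] \<cdot>\<^bsub>K\<^esub> \<one>\<^bsub>K\<^esub> = ([(phi i)] \<cdot> \<one>, \<zero>)"
    using eta_range[of "snd (gp i)"] unfolding phi_def
    by (auto simp: add_pow_int_ge add_pow_int_lt K_minus simp del: gaussian_extension_simps(4))
      (auto simp: K_minus)
  then show ?thesis by (simp add: scalar_pow eta_euler phi_def)
qed

text \<open>With x running through the powers of g^(q-1), which are the (q+1)-th roots of unity,
  this is the sum of (1 - x)^n x^(-l). For n at most q it extracts the coefficient of X^l in (1 -
  X)^n, up to the factor q + 1, which is 1 in K.\<close>

definition power_sum :: "nat \<Rightarrow> int \<Rightarrow> 'a \<times> 'a" where
  "power_sum n l = (\<Oplus>\<^bsub>K\<^esub>i\<in>{..<q + 1}.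
     (\<one>\<^bsub>K\<^esub> \<ominus>\<^bsub>K\<^esub> gp ((int q - 1) * int i)) [^]\<^bsub>K\<^esub> n \<otimes>\<^bsub>K\<^esub> gp (- (int q - 1) * l * int i))"


lemma power_sum_closed: "power_sum n l \<in> carrier K"
  unfolding power_sum_def using gp_closed by (intro K.finsum_closed) (auto simp del: gaussian_extension_simps)

lemma gp_multiple: "(int q - 1) * (int q + 1) dvd i \<Longrightarrow> gp i = \<one>\<^bsub>K\<^esub>"
  using gp_eq_iff[of i 0] gp_0 by simp

text \<open>Pascal's rule in place of an expansion: (1 - x)^(n+1) x^(-l) = (1 - x)^n x^(-l) - (1 -
  x)^n x^(1-l). The case n = 0 is a geometric sum.\<close>

lemma power_sum_eq:
  assumes q0: "[q] \<cdot>\<^bsub>K\<^esub> \<one>\<^bsub>K\<^esub> = \<zero>\<^bsub>K\<^esub>" and "n \<le> q" "l \<le> q"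
  shows "power_sum n (int l) = [(parity_sign (int l) * int (n choose l))] \<cdot>\<^bsub>K\<^esub> \<one>\<^bsub>K\<^esub>"
  using assms(2,3)
proof (induction n arbitrary: l)
  case 0
  define y where "y = gp (- (int q - 1) * int l)"
  have yc: "y \<in> carrier K" unfolding y_def by (rule gp_closed)
  have yp: "y [^]\<^bsub>K\<^esub> (i::nat) = gp (- (int q - 1) * int l * int i)" for i
    unfolding y_def by (rule gp_pow)
  have eq: "power_sum 0 (int l) = (\<Oplus>\<^bsub>K\<^esub>i\<in>{..<q + 1}. y [^]\<^bsub>K\<^esub> i)"
    unfolding power_sum_def yp using gp_closed
    by (intro K.finsum_cong') (auto simp del: gaussian_extension_simps)
  show ?case
  proof (cases "l = 0")
    case True
    then have "y = \<one>\<^bsub>K\<^esub>" by (simp add: y_def gp_0 del: gaussian_extension_simps)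
    then have "(\<Oplus>\<^bsub>K\<^esub>i\<in>{..<q + 1}. y [^]\<^bsub>K\<^esub> i) = (\<Oplus>\<^bsub>K\<^esub>i\<in>{..<q + 1}. \<one>\<^bsub>K\<^esub>)"
      by (simp del: gaussian_extension_simps)
    also have "\<dots> = [(q + 1)] \<cdot>\<^bsub>K\<^esub> \<one>\<^bsub>K\<^esub>"
      using K.add.finprod_const[of "\<one>\<^bsub>K\<^esub>" "{..<q + 1}"] K.one_closed by (simp del: gaussian_extension_simps)
    also have "\<dots> = \<one>\<^bsub>K\<^esub>" using q0 K.one_closed by (simp del: gaussian_extension_simps)
    finally show ?thesis unfolding eq using True K.one_closed
      by (simp add: parity_sign_def add_pow_int_ge del: gaussian_extension_simps)
  next
    case False
    have "y [^]\<^bsub>K\<^esub> (q + 1) = \<one>\<^bsub>K\<^esub>"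
      unfolding yp by (rule gp_multiple, rule dvdI[of _ _ "- int l"]) (simp add: algebra_simps)
    then have "(\<Oplus>\<^bsub>K\<^esub>i\<in>{..<q + 1}. y [^]\<^bsub>K\<^esub> i) \<otimes>\<^bsub>K\<^esub> (y \<ominus>\<^bsub>K\<^esub> \<one>\<^bsub>K\<^esub>) = \<zero>\<^bsub>K\<^esub>"
      using K.finsum_geometric[OF yc, of "q + 1"] K.r_right_minus_eq[OF K.one_closed K.one_closed] by metis
    moreover have "y \<ominus>\<^bsub>K\<^esub> \<one>\<^bsub>K\<^esub> \<noteq> \<zero>\<^bsub>K\<^esub>"
    proof
      assume "y \<ominus>\<^bsub>K\<^esub> \<one>\<^bsub>K\<^esub> = \<zero>\<^bsub>K\<^esub>"
      then have "y = gp 0" using K.r_right_minus_eq[OF yc K.one_closed] gp_0 by metis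
      then have "(int q - 1) * (int q + 1) dvd (int q - 1) * (- int l)"
        unfolding y_def gp_eq_iff by (simp only: diff_0_right mult_minus_left mult_minus_right)
      then have "int q + 1 dvd - int l" using q_ge_3 by (simp only: dvd_mult_cancel_left) simp
      then have "int q + 1 dvd int l" by simp
      then have "int q + 1 \<le> int l" using False by (intro zdvd_imp_le) auto
      then show False using \<open>l \<le> q\<close> by simp
    qed
    moreover have "(\<Oplus>\<^bsub>K\<^esub>i\<in>{..<q + 1}. y [^]\<^bsub>K\<^esub> i) \<in> carrier K"
      using yc by (intro K.finsum_closed) (auto simp del: gaussian_extension_simps)
    moreover have "y \<ominus>\<^bsub>K\<^esub> \<one>\<^bsub>K\<^esub> \<in> carrier K" using yc K.one_closed by (rule K.minus_closed)
    ultimately have "(\<Oplus>\<^bsub>K\<^esub>i\<in>{..<q + 1}. y [^]\<^bsub>K\<^esub> i) = \<zero>\<^bsub>K\<^esub>" using K.integral by blast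
    then show ?thesis unfolding eq using False
      by (simp add: add_pow_int_ge binomial_eq_0 del: gaussian_extension_simps)
  qed
next
  case (Suc n)
  have step: "power_sum (Suc n) k = power_sum n k \<ominus>\<^bsub>K\<^esub> power_sum n (k - 1)" for k
  proof -
    let ?u = "\<lambda>i::nat. \<one>\<^bsub>K\<^esub> \<ominus>\<^bsub>K\<^esub> gp ((int q - 1) * int i)"
    let ?g = "\<lambda>k i. gp (- (int q - 1) * k * int i)"
    have u: "?u i \<in> carrier K" for i using K.one_closed gp_closed by (rule K.minus_closed)
    have "power_sum (Suc n) k \<oplus>\<^bsub>K\<^esub> power_sum n (k - 1) =
        (\<Oplus>\<^bsub>K\<^esub>i\<in>{..<q + 1}. ?u i [^]\<^bsub>K\<^esub> Suc n \<otimes>\<^bsub>K\<^esub> ?g k i \<oplus>\<^bsub>K\<^esub> ?u i [^]\<^bsub>K\<^esub> n \<otimes>\<^bsub>K\<^esub> ?g (k - 1) i)"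
      unfolding power_sum_def using u gp_closed
      by (intro K.finsum_addf[symmetric] funcsetI K.m_closed K.nat_pow_closed) auto
    also have "\<dots> = power_sum n k"
      unfolding power_sum_def
    proof (rule K.finsum_cong')
      show "(\<lambda>i. ?u i [^]\<^bsub>K\<^esub> n \<otimes>\<^bsub>K\<^esub> ?g k i) \<in> {..<q + 1} \<rightarrow> carrier K"
        using u gp_closed by (intro funcsetI K.m_closed K.nat_pow_closed) auto
      fix i assume "i \<in> {..<q + 1}"
      have "- (int q - 1) * (k - 1) * int i = (int q - 1) * int i + - (int q - 1) * k * int i"
        by (simp add: algebra_simps)
      then have g: "?g (k - 1) i = gp ((int q - 1) * int i) \<otimes>\<^bsub>K\<^esub> ?g k i" by (simp only: gp_add)
      have alg: "P \<otimes>\<^bsub>K\<^esub> (\<one>\<^bsub>K\<^esub> \<ominus>\<^bsub>K\<^esub> x) \<otimes>\<^bsub>K\<^esub> y \<oplus>\<^bsub>K\<^esub> P \<otimes>\<^bsub>K\<^esub> (x \<otimes>\<^bsub>K\<^esub> y) = P \<otimes>\<^bsub>K\<^esub> y"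
        if "P \<in> carrier K" "x \<in> carrier K" "y \<in> carrier K" for P x y
      proof -
        have "P \<otimes>\<^bsub>K\<^esub> (\<one>\<^bsub>K\<^esub> \<ominus>\<^bsub>K\<^esub> x) \<otimes>\<^bsub>K\<^esub> y \<oplus>\<^bsub>K\<^esub> P \<otimes>\<^bsub>K\<^esub> (x \<otimes>\<^bsub>K\<^esub> y) =
            P \<otimes>\<^bsub>K\<^esub> y \<otimes>\<^bsub>K\<^esub> ((\<one>\<^bsub>K\<^esub> \<ominus>\<^bsub>K\<^esub> x) \<oplus>\<^bsub>K\<^esub> x)"
          using that K.one_closed K.minus_closed[OF K.one_closed that(2)]
          by (simp add: K.r_distr K.m_ac K.m_closed del: gaussian_extension_simps)
        also have "(\<one>\<^bsub>K\<^esub> \<ominus>\<^bsub>K\<^esub> x) \<oplus>\<^bsub>K\<^esub> x = \<one>\<^bsub>K\<^esub>"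
          using that K.one_closed by (simp add: K.minus_eq K.a_assoc K.l_neg del: gaussian_extension_simps)
        finally show ?thesis using that by (simp del: gaussian_extension_simps)
      qed
      show "?u i [^]\<^bsub>K\<^esub> Suc n \<otimes>\<^bsub>K\<^esub> ?g k i \<oplus>\<^bsub>K\<^esub> ?u i [^]\<^bsub>K\<^esub> n \<otimes>\<^bsub>K\<^esub> ?g (k - 1) i =
          ?u i [^]\<^bsub>K\<^esub> n \<otimes>\<^bsub>K\<^esub> ?g k i"
        unfolding g nat_pow_Suc K.nat_pow_Suc by (rule alg[OF K.nat_pow_closed[OF u] gp_closed gp_closed])
    qed simp
    finally have e: "power_sum (Suc n) k \<oplus>\<^bsub>K\<^esub> power_sum n (k - 1) = power_sum n k" .
    show ?thesis unfolding e[symmetric] using power_sum_closed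
      by (simp add: K.minus_eq K.a_assoc K.r_neg del: gaussian_extension_simps)
  qed
  have diff: "[x] \<cdot>\<^bsub>K\<^esub> \<one>\<^bsub>K\<^esub> \<ominus>\<^bsub>K\<^esub> [y] \<cdot>\<^bsub>K\<^esub> \<one>\<^bsub>K\<^esub> = [(x - y)] \<cdot>\<^bsub>K\<^esub> \<one>\<^bsub>K\<^esub>" for x y :: int
    using K.add.int_pow_diff[OF K.one_closed, of x y] by (simp only: K.minus_eq)
  show ?case
  proof (cases l)
    case 0
    \<comment> \<open>The recursion leads to the index - 1, which is why the index is an integer.
      Modulo q + 1 it is q, where the coefficient vanishes because n < q.\<close>
    have "power_sum n (- 1) = power_sum n (int q)"
    proof -
      have "gp (- (int q - 1) * (- 1) * int i) = gp (- (int q - 1) * int q * int i)" for i :: nat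
        unfolding gp_eq_iff by (rule dvdI[of _ _ "int i"]) (simp add: algebra_simps)
      then show ?thesis unfolding power_sum_def by (simp only:)
    qed
    also have "\<dots> = [(0::int)] \<cdot>\<^bsub>K\<^esub> \<one>\<^bsub>K\<^esub>"
      using Suc.IH[of q] Suc.prems by (simp add: binomial_eq_0 del: gaussian_extension_simps)
    finally have "power_sum (Suc n) 0 = [(parity_sign 0 * int (n choose 0))] \<cdot>\<^bsub>K\<^esub> \<one>\<^bsub>K\<^esub> \<ominus>\<^bsub>K\<^esub> [(0::int)] \<cdot>\<^bsub>K\<^esub> \<one>\<^bsub>K\<^esub>"
      using step[of 0] Suc.IH[of 0] Suc.prems by (simp del: gaussian_extension_simps)
    then show ?thesis unfolding diff using 0 by (simp del: gaussian_extension_simps)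
  next
    case (Suc k)
    have "power_sum (Suc n) (int l) = power_sum n (int l) \<ominus>\<^bsub>K\<^esub> power_sum n (int k)"
      using step[of "int l"] Suc by simp
    also have "\<dots> = [(parity_sign (int l) * int (n choose l) - parity_sign (int k) * int (n choose k))] \<cdot>\<^bsub>K\<^esub> \<one>\<^bsub>K\<^esub>"
      using Suc.IH[of l] Suc.IH[of k] Suc.prems Suc by (simp only: diff)
    also have "parity_sign (int l) * int (n choose l) - parity_sign (int k) * int (n choose k) =
        parity_sign (int l) * int (Suc n choose l)"
      using Suc by (simp add: parity_sign_def)
    finally show ?thesis .
  qed
qed

end

section \<open>A Gauss-type sum modulo p\<close>

context gaussian_exponential
begin

text \<open>The sum T is evaluated twice: it is a combination of the class sums, hence zero if p
  divides A and B; and multiplied by (2 sqrt(-1))^N it is \<open>power_sum N w\<close>, up to sign a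
  binomial coefficient prime to p.\<close>

lemma class_sums_not_both_divisible:
  assumes p: "prime (p::nat)" and qp: "q = p ^ r" and q8: "q mod 8 = 3" and t: "q + 1 = 4 * t"
  shows "\<not> (int p dvd reflective_antiperiodic.class_sum phi t 1 \<and>
             int p dvd reflective_antiperiodic.class_sum phi t 2)"
proof
  note [simp del] = gaussian_extension_simps
  define w where "w = q div 8"
  have qw: "q = 8 * w + 3" unfolding w_def using q8 by presburger
  have tw: "t = 2 * w + 1" using t qw by simp
  have odd_t: "odd t" using tw by simp
  interpret A: reflective_antiperiodic phi t by (rule phi_reflective_antiperiodic[OF t odd_t])
  assume "int p dvd A.class_sum 1 \<and> int p dvd A.class_sum 2"
  then have d1: "int p dvd A.class_sum 1" and d2: "int p dvd A.class_sum 2" by auto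
  have d0: "int p dvd A.class_sum 0" and d3: "int p dvd A.class_sum 3"
    using d1 by (auto simp: A.class_sum_0 A.class_sum_3)
  define N where "N = 4 * w + 1"
  have N: "(q - 1) div 2 = N" "int q - 1 = 2 * int N" using qw by (simp_all add: N_def)
  have qt: "int q + 1 = 4 * int t" using t by linarith
  \<comment> \<open>N is (q - 1) / 2 and t is (q + 1) / 4, so D is (q^2 - 1) / 8 and g^D has order
    8.\<close>
  define D where "D = int N * int t"
  have D8: "(int q - 1) * (int q + 1) = 8 * D" unfolding N(2) qt D_def by simp
  have D0: "D > 0" using tw by (simp add: D_def N_def)
  have "[(p ^ (2 * r))] \<cdot>\<^bsub>K\<^esub> \<one>\<^bsub>K\<^esub> = \<zero>\<^bsub>K\<^esub>"
    using K.add_pow_card_carrier[OF K.one_closed] unfolding card_K qp by (simp add: mult_2 power_add)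
  then have p0: "[p] \<cdot>\<^bsub>K\<^esub> \<one>\<^bsub>K\<^esub> = \<zero>\<^bsub>K\<^esub>" by (rule K.add_pow_prime_power_zero)
  have "r \<noteq> 0" using qp q8 by (intro notI) simp
  then have "int p dvd int q" using qp by simp
  then have "[(int q)] \<cdot>\<^bsub>K\<^esub> \<one>\<^bsub>K\<^esub> = \<zero>\<^bsub>K\<^esub>" by (rule K.add_pow_int_dvd[OF p0 _ K.one_closed])
  then have q0: "[q] \<cdot>\<^bsub>K\<^esub> \<one>\<^bsub>K\<^esub> = \<zero>\<^bsub>K\<^esub>" by (simp add: add_pow_int_ge)
  define h where "h i = gp (- D * int i)" for i :: nat
  have hc: "h i \<in> carrier K" for i unfolding h_def by (rule gp_closed)
  have "gp (- D * 4) = \<ominus>\<^bsub>K\<^esub> \<one>\<^bsub>K\<^esub>"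
  proof (rule K.square_eq_one_imp_minus_one[OF gp_closed])
    show "gp (- D * 4) \<otimes>\<^bsub>K\<^esub> gp (- D * 4) = \<one>\<^bsub>K\<^esub>"
      unfolding gp_add[symmetric] by (rule gp_multiple) (simp add: D8)
    show "gp (- D * 4) \<noteq> \<one>\<^bsub>K\<^esub>"
    proof
      assume "gp (- D * 4) = \<one>\<^bsub>K\<^esub>"
      then have "8 * D dvd - D * 4" unfolding gp_0[symmetric] gp_eq_iff D8 by simp
      then have "8 * D dvd D * 4" by simp
      then have "8 * D \<le> D * 4" using D0 by (intro zdvd_imp_le) auto
      then show False using D0 by simp
    qed
  qed
  then have anti: "h (i + 4) = \<ominus>\<^bsub>K\<^esub> h i" for i
  proof -
    have "- D * int (i + 4) = - D * 4 + - D * int i" by (simp add: algebra_simps)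
    then have "h (i + 4) = gp (- D * 4) \<otimes>\<^bsub>K\<^esub> h i" unfolding h_def by (simp only: gp_add)
    also have "\<dots> = \<ominus>\<^bsub>K\<^esub> h i" unfolding \<open>gp (- D * 4) = \<ominus>\<^bsub>K\<^esub> \<one>\<^bsub>K\<^esub>\<close>
      using hc[of i] K.one_closed by (simp add: K.l_minus)
    finally show ?thesis .
  qed
  have cs: "(\<Sum>j<t. parity_sign (int j) * phi (int (4 * j + s))) = A.class_sum (int s)" for s :: nat
    by (simp add: A.class_sum_def)
  define T where "T = (\<Oplus>\<^bsub>K\<^esub>i\<in>{..<q + 1}. [(phi (int i))] \<cdot>\<^bsub>K\<^esub> h i)"
  have "T = [(A.class_sum 0)] \<cdot>\<^bsub>K\<^esub> h 0 \<oplus>\<^bsub>K\<^esub> [(A.class_sum 1)] \<cdot>\<^bsub>K\<^esub> h 1 \<oplus>\<^bsub>K\<^esub>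
      [(A.class_sum 2)] \<cdot>\<^bsub>K\<^esub> h 2 \<oplus>\<^bsub>K\<^esub> [(A.class_sum 3)] \<cdot>\<^bsub>K\<^esub> h 3"
    unfolding T_def t K.finsum_antiperiodic[of h "\<lambda>i. phi (int i)" t, OF hc anti]
    using cs[of 0] cs[of 1] cs[of 2] cs[of 3] by simp
  also have "\<dots> = \<zero>\<^bsub>K\<^esub>"
    unfolding K.add_pow_int_dvd[OF p0 d0 hc] K.add_pow_int_dvd[OF p0 d1 hc]
      K.add_pow_int_dvd[OF p0 d2 hc] K.add_pow_int_dvd[OF p0 d3 hc] by simp
  finally have T0: "T = \<zero>\<^bsub>K\<^esub>" .
  \<comment> \<open>k is 2 sqrt(-1), so that k times Im z is z - cj z = z (1 - z^(q-1)).\<close>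
  define k where "k = (\<zero>, \<one> \<oplus> \<one>)"
  have kc: "k \<in> carrier K" by (simp add: k_def gaussian_extension_simps)
  have imk: "(snd (gp i), \<zero>) \<otimes>\<^bsub>K\<^esub> k = gp i \<otimes>\<^bsub>K\<^esub> (\<one>\<^bsub>K\<^esub> \<ominus>\<^bsub>K\<^esub> gp ((int q - 1) * i))" for i
  proof -
    obtain a b where ab: "gp i = (a, b)" "a \<in> carrier F" "b \<in> carrier F"
      using gp_closed[of i] by (auto simp: gaussian_extension_simps)
    have "gp i \<otimes>\<^bsub>K\<^esub> (\<one>\<^bsub>K\<^esub> \<ominus>\<^bsub>K\<^esub> gp ((int q - 1) * i)) =
        gp i \<ominus>\<^bsub>K\<^esub> gp i \<otimes>\<^bsub>K\<^esub> gp ((int q - 1) * i)"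
      using gp_closed K.one_closed by (simp add: K.minus_eq K.r_distr K.r_minus)
    also have "gp i \<otimes>\<^bsub>K\<^esub> gp ((int q - 1) * i) = cj (gp i)"
      unfolding cj_gp gp_add[symmetric] by (simp add: algebra_simps)
    also have "gp i \<ominus>\<^bsub>K\<^esub> cj (gp i) = (\<zero>, b \<oplus> b)"
      using ab by (simp add: K.minus_eq cj_def K_minus gaussian_extension_simps r_neg)
    also have "\<dots> = (snd (gp i), \<zero>) \<otimes>\<^bsub>K\<^esub> k"
      using ab by (simp add: k_def gaussian_extension_simps r_distr minus_eq)
    finally show ?thesis by simp
  qed
  have uc: "\<one>\<^bsub>K\<^esub> \<ominus>\<^bsub>K\<^esub> gp i \<in> carrier K" for i
    using K.one_closed gp_closed by (rule K.minus_closed)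
  have tm: "([(phi (int i))] \<cdot>\<^bsub>K\<^esub> h i) \<otimes>\<^bsub>K\<^esub> k [^]\<^bsub>K\<^esub> N =
      (\<one>\<^bsub>K\<^esub> \<ominus>\<^bsub>K\<^esub> gp ((int q - 1) * int i)) [^]\<^bsub>K\<^esub> N \<otimes>\<^bsub>K\<^esub> gp (- (int q - 1) * int w * int i)" for i
  proof -
    have sc: "(snd (gp (int i)), \<zero>) \<in> carrier K" by (simp add: gaussian_extension_simps)
    have kN: "k [^]\<^bsub>K\<^esub> N \<in> carrier K" using kc by simp
    have "[(phi (int i))] \<cdot>\<^bsub>K\<^esub> h i = ([(phi (int i))] \<cdot>\<^bsub>K\<^esub> \<one>\<^bsub>K\<^esub>) \<otimes>\<^bsub>K\<^esub> h i"
      using hc K.one_closed by (simp add: K.add_pow_ldistr_int)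
    also have "[(phi (int i))] \<cdot>\<^bsub>K\<^esub> \<one>\<^bsub>K\<^esub> = (snd (gp (int i)), \<zero>) [^]\<^bsub>K\<^esub> N"
      unfolding phi_euler N(1) ..
    finally have "([(phi (int i))] \<cdot>\<^bsub>K\<^esub> h i) \<otimes>\<^bsub>K\<^esub> k [^]\<^bsub>K\<^esub> N =
        ((snd (gp (int i)), \<zero>) [^]\<^bsub>K\<^esub> N \<otimes>\<^bsub>K\<^esub> k [^]\<^bsub>K\<^esub> N) \<otimes>\<^bsub>K\<^esub> h i"
      using sc kN hc[of i] by (simp add: K.m_ac)
    also have "(snd (gp (int i)), \<zero>) [^]\<^bsub>K\<^esub> N \<otimes>\<^bsub>K\<^esub> k [^]\<^bsub>K\<^esub> N =
        (gp (int i) \<otimes>\<^bsub>K\<^esub> (\<one>\<^bsub>K\<^esub> \<ominus>\<^bsub>K\<^esub> gp ((int q - 1) * int i))) [^]\<^bsub>K\<^esub> N"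
      unfolding imk[symmetric] using sc kc by (rule K.nat_pow_distrib[symmetric])
    also have "\<dots> = gp (int i * int N) \<otimes>\<^bsub>K\<^esub> (\<one>\<^bsub>K\<^esub> \<ominus>\<^bsub>K\<^esub> gp ((int q - 1) * int i)) [^]\<^bsub>K\<^esub> N"
      unfolding gp_pow[symmetric, of "int i" N] using gp_closed uc by (rule K.nat_pow_distrib)
    also have "\<dots> \<otimes>\<^bsub>K\<^esub> h i =
        (\<one>\<^bsub>K\<^esub> \<ominus>\<^bsub>K\<^esub> gp ((int q - 1) * int i)) [^]\<^bsub>K\<^esub> N \<otimes>\<^bsub>K\<^esub> (gp (int i * int N) \<otimes>\<^bsub>K\<^esub> h i)"
      using gp_closed[of "int i * int N"] K.nat_pow_closed[OF uc] hc by (simp add: K.m_ac)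
    also have "gp (int i * int N) \<otimes>\<^bsub>K\<^esub> h i = gp (int i * int N + - D * int i)"
      unfolding h_def by (rule gp_add[symmetric])
    \<comment> \<open>N - D = N (1 - t) = - 2 N w = - (q - 1) w: this choice of D leaves a power of
      g^(q-1), as \<open>power_sum\<close> requires.\<close>
    also have "int i * int N + - D * int i = - (int q - 1) * int w * int i"
      unfolding N(2) D_def tw by (simp add: algebra_simps)
    finally show ?thesis .
  qed
  have "T \<otimes>\<^bsub>K\<^esub> k [^]\<^bsub>K\<^esub> N = (\<Oplus>\<^bsub>K\<^esub>i\<in>{..<q + 1}. ([(phi (int i))] \<cdot>\<^bsub>K\<^esub> h i) \<otimes>\<^bsub>K\<^esub> k [^]\<^bsub>K\<^esub> N)"
    unfolding T_def using hc kc by (intro K.finsum_ldistr) auto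
  also have "\<dots> = power_sum N (int w)" unfolding tm power_sum_def ..
  also have "\<dots> = [(parity_sign (int w) * int (N choose w))] \<cdot>\<^bsub>K\<^esub> \<one>\<^bsub>K\<^esub>"
    using qw by (intro power_sum_eq[OF q0]) (auto simp: N_def)
  finally have "[(parity_sign (int w) * int (N choose w))] \<cdot>\<^bsub>K\<^esub> \<one>\<^bsub>K\<^esub> = \<zero>\<^bsub>K\<^esub>"
    unfolding T0 using kc by simp
  then have "[(parity_sign (int w))] \<cdot>\<^bsub>K\<^esub> ([(parity_sign (int w) * int (N choose w))] \<cdot>\<^bsub>K\<^esub> \<one>\<^bsub>K\<^esub>) = \<zero>\<^bsub>K\<^esub>"
    by (simp add: parity_sign_def add_pow_int_ge add_pow_int_lt)
  then have "[(parity_sign (int w) * int (N choose w) * parity_sign (int w))] \<cdot>\<^bsub>K\<^esub> \<one>\<^bsub>K\<^esub> = \<zero>\<^bsub>K\<^esub>"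
    by (simp only: K.add.int_pow_pow[OF K.one_closed])
  moreover have "parity_sign (int w) * int (N choose w) * parity_sign (int w) = int (N choose w)"
    by (simp add: parity_sign_def)
  ultimately have "[(int (N choose w))] \<cdot>\<^bsub>K\<^esub> \<one>\<^bsub>K\<^esub> = \<zero>\<^bsub>K\<^esub>" by (simp only:)
  then have "[(N choose w)] \<cdot>\<^bsub>K\<^esub> \<one>\<^bsub>K\<^esub> = \<zero>\<^bsub>K\<^esub>" by (simp add: add_pow_int_ge)
  moreover have "coprime (N choose w) p"
  proof -
    have "(q - 3) div 8 = w" using qw by simp
    then have "\<not> p dvd (N choose w)" using prime_not_dvd_binomial_half_eighth[OF p qp q8] N(1) by simp
    then show ?thesis using prime_imp_coprime[OF p] by (subst coprime_commute)
  qed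
  ultimately have "\<one>\<^bsub>K\<^esub> = \<zero>\<^bsub>K\<^esub>" using p0 by (intro K.add_pow_coprime_imp_trivial)
  then show False using K.one_not_zero by simp
qed

end

section \<open>The Paley matrix\<close>

context finite_field_3_mod_4
begin

text \<open>Homogeneous coordinates on the projective line over F, with (0, 1) for the border and
  (1, x) for x in F. The determinant of (1, x) and (1, y) is y - x, as in the definition of
  M.\<close>

definition projective_point :: "(nat \<Rightarrow> 'a) \<Rightarrow> nat \<Rightarrow> 'a \<times> 'a" where
  "projective_point e a = (case a of 0 \<Rightarrow> (\<zero>, \<one>) | Suc i \<Rightarrow> (\<one>, e i))"

definition conference :: "(nat \<Rightarrow> 'a) \<Rightarrow> nat \<Rightarrow> nat \<Rightarrow> int" where
  "conference e a b = eta (snd (cj (projective_point e a) \<otimes>\<^bsub>K\<^esub> projective_point e b))"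

lemma projective_point_nonzero: "projective_point e a \<noteq> \<zero>\<^bsub>K\<^esub>"
  by (auto simp: projective_point_def split: nat.split)

lemma bordered_mat_carrier: "bordered_mat_of_field F q e \<in> carrier_mat (q + 1) (q + 1)"
  by (rule carrier_matI) (simp_all add: bordered_mat_of_field_def square_mat_of_field_def)

context
  fixes e :: "nat \<Rightarrow> 'a"
  assumes e: "bij_betw e {..<q} (carrier F)"
begin

lemma e_closed: "i < q \<Longrightarrow> e i \<in> carrier F"
  using bij_betw_apply[OF e] by simp

lemma e_inj: "i < q \<Longrightarrow> j < q \<Longrightarrow> e i = e j \<longleftrightarrow> i = j"
  using bij_betw_imp_inj_on[OF e] by (auto dest: inj_onD)

lemma sum_over_e: "(\<Sum>j<q. G (e j)) = (\<Sum>c\<in>carrier F. (G c :: int))"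
  by (rule sum.reindex_bij_betw[OF e])

lemma projective_point_closed: "a < q + 1 \<Longrightarrow> projective_point e a \<in> carrier K"
  using e_closed by (auto simp: projective_point_def split: nat.split)

lemma conference_simps:
  "conference e 0 0 = 0"
  "j < q \<Longrightarrow> conference e 0 (Suc j) = - 1"
  "i < q \<Longrightarrow> conference e (Suc i) 0 = 1"
  "i < q \<Longrightarrow> j < q \<Longrightarrow> conference e (Suc i) (Suc j) = eta (e j \<ominus> e i)"
  using e_closed[of i] e_closed[of j]
  by (simp_all add: conference_def projective_point_def cj_def eta_minus_one minus_eq)

lemma conference_diag: "a < q + 1 \<Longrightarrow> conference e a a = 0"
  using e_closed by (cases a) (auto simp: conference_simps minus_eq r_neg)

lemma conference_off: "a < q + 1 \<Longrightarrow> b < q + 1 \<Longrightarrow> a \<noteq> b \<Longrightarrow> conference e a b = 1 \<or> conference e a b = - 1"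
proof (cases a; cases b)
  fix i j assume *: "a < q + 1" "b < q + 1" "a \<noteq> b" "a = Suc i" "b = Suc j"
  then have "e j \<noteq> e i" using e_inj[of j i] by simp
  then have "e j \<ominus> e i \<noteq> \<zero>" using * e_closed by simp
  then show ?thesis using * eta_range[of "e j \<ominus> e i"] eta_eq_0_iff[of "e j \<ominus> e i"] by (simp add: conference_simps)
qed (auto simp: conference_simps)

lemma conference_skew: "a < q + 1 \<Longrightarrow> b < q + 1 \<Longrightarrow> conference e b a = - conference e a b"
proof (cases a; cases b)
  fix i j assume *: "a < q + 1" "b < q + 1" "a = Suc i" "b = Suc j"
  then have c: "e i \<in> carrier F" "e j \<in> carrier F" using e_closed by auto
  then have "e i \<ominus> e j = \<ominus> (e j \<ominus> e i)" by (simp add: minus_eq minus_add a_comm)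
  then show ?thesis using * c eta_minus[of "e j \<ominus> e i"] by (simp add: conference_simps)
qed (auto simp: conference_simps)

text \<open>For two distinct rows off the border, the border column contributes 1 and
  \<open>sum_eta_shift_product\<close> contributes - 1; against the border row only a translate of
  \<open>sum_eta\<close> remains.\<close>

lemma conference_orth:
  assumes "a < q + 1" "c < q + 1"
  shows "(\<Sum>b<q + 1. conference e a b * conference e c b) = (if a = c then int q else 0)"
proof -
  have split: "(\<Sum>b<q + 1. G b) = G 0 + (\<Sum>j<q. G (Suc j))" for G :: "nat \<Rightarrow> int"
    by (simp add: sum.lessThan_Suc_shift del: sum.lessThan_Suc)
  have shift0: "(\<Sum>j<q. eta (e j \<ominus> x)) = 0" if "x \<in> carrier F" for x
    using sum_over_e[of "\<lambda>c. eta (c \<ominus> x)"] sum_translate[OF that, of eta] sum_eta by simp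
  show ?thesis
  proof (cases a)
    case a: 0
    show ?thesis
    proof (cases c)
      case 0
      then show ?thesis unfolding split using a by (simp add: conference_simps)
    next
      case (Suc i)
      then have i: "i < q" using assms by simp
      have "(\<Sum>j<q. conference e a (Suc j) * conference e c (Suc j)) = - (\<Sum>j<q. eta (e j \<ominus> e i))"
        using a Suc i by (simp add: conference_simps sum_negf)
      then show ?thesis unfolding split using a Suc i shift0[OF e_closed[OF i]] by (simp add: conference_simps)
    qed
  next
    case a: (Suc i)
    then have i: "i < q" using assms by simp
    show ?thesis
    proof (cases c)
      case 0
      have "(\<Sum>j<q. conference e a (Suc j) * conference e c (Suc j)) = - (\<Sum>j<q. eta (e j \<ominus> e i))"
        using a 0 i by (simp add: conference_simps sum_negf)
      then show ?thesis unfolding split using a 0 i shift0[OF e_closed[OF i]] by (simp add: conference_simps)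
    next
      case c: (Suc k)
      then have k: "k < q" using assms by simp
      have cl: "e i \<in> carrier F" "e k \<in> carrier F" using i k e_closed by auto
      define d where "d = e i \<ominus> e k"
      have d: "d \<in> carrier F" using cl by (simp add: d_def)
      have "(\<Sum>j<q. conference e a (Suc j) * conference e c (Suc j)) =
          (\<Sum>j<q. eta (e j \<ominus> e i) * eta (e j \<ominus> e i \<oplus> d))"
      proof (intro sum.cong refl)
        fix j assume "j \<in> {..<q}"
        then have j: "j < q" "e j \<in> carrier F" using e_closed by auto
        have "e j \<ominus> e k = e j \<ominus> e i \<oplus> d"
          using j(2) cl by (simp add: d_def minus_eq a_assoc r_neg1)
        then show "conference e a (Suc j) * conference e c (Suc j) = eta (e j \<ominus> e i) * eta (e j \<ominus> e i \<oplus> d)"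
          using a c i k j by (simp add: conference_simps)
      qed
      also have "\<dots> = (\<Sum>x\<in>carrier F. eta (x \<ominus> e i) * eta (x \<ominus> e i \<oplus> d))" by (rule sum_over_e)
      also have "\<dots> = (\<Sum>x\<in>carrier F. eta x * eta (x \<oplus> d))"
        by (rule sum_translate[OF cl(1), of "\<lambda>x. eta x * eta (x \<oplus> d)"])
      also have "\<dots> = (if a = c then int q - 1 else - 1)"
      proof (cases "a = c")
        case True
        then have "d = \<zero>" using a c cl by (simp add: d_def minus_eq r_neg)
        then have "(\<Sum>x\<in>carrier F. eta x * eta (x \<oplus> d)) = (\<Sum>x\<in>carrier F. if x = \<zero> then 0 else 1)"
          by (intro sum.cong refl) (auto simp: eta_def)
        also have "\<dots> = (\<Sum>x\<in>carrier F - {\<zero>}. 1)"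
          using finite_carrier by (simp add: sum.remove[of _ \<zero>])
        also have "\<dots> = int q - 1" using finite_carrier card_carrier q_ge_3 by (simp add: of_nat_diff)
        finally show ?thesis using True by simp
      next
        case False
        then have "e i \<noteq> e k" using a c e_inj[OF i k] by simp
        then have "d \<noteq> \<zero>" using cl by (simp add: d_def)
        then show ?thesis using False sum_eta_shift_product[OF d] by simp
      qed
      finally show ?thesis unfolding split using a c i k by (simp add: conference_simps)
    qed
  qed
qed

text \<open>Counting 0 as a square puts 1 on the diagonal of M, which is the I of I + S; the only
  other difference is the sign of the first row.\<close>

lemma bordered_mat_eq:
  assumes "a < q + 1" "b < q + 1"
  shows "bordered_mat_of_field F q e $$ (a, b) =
    (if a = 0 then - 1 else 1) * ((if a = b then 1 else 0) + conference e a b)"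
proof (cases a; cases b)
  fix i j assume *: "a = Suc i" "b = Suc j"
  then have ij: "i < q" "j < q" using assms by auto
  have "bordered_mat_of_field F q e $$ (a, b) = (if is_square (e j \<ominus> e i) then 1 else - 1)"
    using * ij by (simp add: bordered_mat_of_field_def square_mat_of_field_def is_square_def)
  moreover have "is_square \<zero>" by (auto simp: is_square_def intro: bexI[of _ \<zero>])
  moreover have "e j \<ominus> e i = \<zero> \<longleftrightarrow> i = j" using ij e_closed e_inj by auto
  ultimately show ?thesis using * ij by (auto simp: conference_simps eta_def)
qed (use assms in \<open>auto simp: bordered_mat_of_field_def square_mat_of_field_def conference_simps\<close>)

end

end

section \<open>Assembly of the pieces for a given field\<close>

lemma bordered_mat_switching:
  fixes m :: int and F :: "('a, 'b) ring_scheme"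
  assumes q: "int q = 4 * m\<^sup>2 + 4 * m + 3" and m: "m \<ge> 0" and pp: "primepow q"
    and F: "field F" and e: "bij_betw e {..<q} (carrier F)"
  obtains R C where "R \<subseteq> {..<q + 1}" "C \<subseteq> {..<q + 1}"
    "hadamard_mat (q + 1) (negate_rows_cols R C (bordered_mat_of_field F q e))"
    "q \<noteq> 3 \<Longrightarrow> biregular (negate_rows_cols R C (bordered_mat_of_field F q e))"
    "excess (negate_rows_cols R C (bordered_mat_of_field F q e)) = excess_bound (q + 1)"
proof -
  \<comment> \<open>This parity gives q = 3 modulo 8, and so makes (q + 1) / 4 odd.\<close>
  have "even (m * (m + 1))" by simp
  then obtain u where "m * (m + 1) = 2 * u" by (elim evenE)
  then have "int q = 8 * u + 3" using q by (simp add: power2_eq_square algebra_simps)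
  then have q8: "q mod 8 = 3" by presburger
  then have q4: "q mod 4 = 3" by presburger
  obtain t where t: "q + 1 = 4 * t" "odd t"
  proof (rule that[of "(q + 1) div 4"])
    show "q + 1 = 4 * ((q + 1) div 4)" "odd ((q + 1) div 4)" using q8 by presburger+
  qed
  obtain p r where pr: "prime p" "r > 0" "q = p ^ r" using pp unfolding primepow_def by auto
  have "odd q" using q8 by presburger
  then have oddp: "odd p" using pr by simp
  interpret field F by (rule F)
  interpret finite_field_3_mod_4 F q
    by unfold_locales (use bij_betw_same_card[OF e] q4 in simp_all)
  obtain gp :: "int \<Rightarrow> 'a \<times> 'a" where gp: "\<And>i. gp i \<in> carrier K" "\<And>i. gp i \<noteq> \<zero>\<^bsub>K\<^esub>" "gp 0 = \<one>\<^bsub>K\<^esub>"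
    "\<And>i j. gp (i + j) = gp i \<otimes>\<^bsub>K\<^esub> gp j"
    "\<And>x. x \<in> carrier K \<Longrightarrow> x \<noteq> \<zero>\<^bsub>K\<^esub> \<Longrightarrow> \<exists>i. x = gp i"
    "\<And>i j. gp i = gp j \<longleftrightarrow> (int q - 1) * (int q + 1) dvd i - j"
    by (fact exists_gaussian_exponential)
  interpret gaussian_exponential F q gp by unfold_locales (fact gp)+
  have "\<exists>i. projective_point e a = gp i" if "a < q + 1" for a
    using gp(5)[OF projective_point_closed[OF e that] projective_point_nonzero] .
  then obtain k where k: "\<And>a. a < q + 1 \<Longrightarrow> projective_point e a = gp (k a)" by metis
  have S: "conference e a b = parity_sign (k a) * phi (k b - k a)" if "a < q + 1" "b < q + 1" for a b
    unfolding conference_def k[OF that(1)] k[OF that(2)] by (rule eta_snd_cj_times)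
  have qt: "int q + 1 = 4 * int t" using t(1) by linarith
  interpret paley_type phi t k "conference e"
  proof (intro paley_type.intro phi_reflective_antiperiodic[OF t] paley_type_axioms.intro)
    \<comment> \<open>Points whose exponents agree modulo q + 1 are proportional, so their
      determinant vanishes, whereas off-diagonal entries of S are nonzero.\<close>
    show "inj_on (\<lambda>a. k a mod (4 * int t)) {..<4 * t}"
    proof (rule inj_onI, rule ccontr)
      fix a b assume ab: "a \<in> {..<4 * t}" "b \<in> {..<4 * t}" "k a mod (4 * int t) = k b mod (4 * int t)" "a \<noteq> b"
      then have "int q + 1 dvd k b - k a" unfolding qt by (metis mod_eq_dvd_iff)
      then obtain z where "k b - k a = (int q + 1) * z" by blast
      then have "phi (k b - k a) = 0" using phi_shift[of 0 z] by (simp add: phi_def gp(3))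
      then have "conference e a b = 0" using S ab t by simp
      then show False using conference_off[OF e, of a b] ab t by simp
    qed
    fix a b assume "a < 4 * t" "b < 4 * t"
    then have ab: "a < q + 1" "b < q + 1" using t by simp_all
    show "conference e a b = parity_sign (k a) * phi (k b - k a)" by (rule S[OF ab])
    show "conference e b a = - conference e a b" by (rule conference_skew[OF e ab])
  next
    fix a c assume "a < 4 * t" "c < 4 * t"
    then show "(\<Sum>b<4 * t. conference e a b * conference e c b) = (if a = c then 4 * int t - 1 else 0)"
      using conference_orth[OF e, of a c, unfolded t(1)] qt by auto
  qed
  have "int q = (2 * m + 1)\<^sup>2 + 2" unfolding q by (simp add: power2_eq_square algebra_simps)
  moreover have "(class_sum 2)\<^sup>2 + 2 * (class_sum 1)\<^sup>2 = int q" using class_sum_norm qt by simp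
  ultimately have cs: "(class_sum 1)\<^sup>2 = 1 \<and> (class_sum 2)\<^sup>2 = (2 * m + 1)\<^sup>2"
    by (intro square_plus_two_squares_unique[OF pr(1) oddp pr(3)]
        class_sums_not_both_divisible[OF pr(1,3) q8 t(1)])
  obtain f where f: "\<And>i. f i = 1 \<or> f i = - 1" "\<And>i. f (i + 4) = - f i"
    "\<And>i. \<bar>transform f i\<bar> = \<bar>2 * m - 2\<bar> \<or> \<bar>transform f i\<bar> = 2 * m + 2"
    using exists_two_valued_transform[of m] cs m by metis
  have n: "int (q + 1) = 4 * m\<^sup>2 + 4 * m + 4" using q by simp
  have f2: "(f i)\<^sup>2 = 1" for i using f(1)[of i] by auto
  have nrm: "(\<Sum>a<q + 1. (transform f (k a))\<^sup>2) = int (q + 1) * int (q + 1)"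
    unfolding t(1) sum_transform_squares[of f, OF f(2)] by (simp add: f2)
  have tr: "transform f (k a) = f (k a) + (\<Sum>b<q + 1. conference e a b * f (k b))" if "a < q + 1" for a
    using transform_eq[of f a, OF f(2)] that unfolding t(1) by simp
  obtain R C where RC: "R \<subseteq> {..<q + 1}" "C \<subseteq> {..<q + 1}"
    "hadamard_mat (q + 1) (negate_rows_cols R C (bordered_mat_of_field F q e))"
    "m > 0 \<Longrightarrow> biregular (negate_rows_cols R C (bordered_mat_of_field F q e))"
    "excess (negate_rows_cols R C (bordered_mat_of_field F q e)) =
      (if m = 0 then 8 else int (q + 1) * (2 * m + 1))"
  proof (rule skew_conference_switching[where x = "\<lambda>a. f (k a)" and v = "\<lambda>a. transform f (k a)",
        OF n m bordered_mat_carrier bordered_mat_eq[OF e] _ conference_diag[OF e] conference_off[OF e]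
          conference_skew[OF e] _ f(1) tr f(3) nrm])
    show "(if a = 0 then - 1 else 1) = (1::int) \<or> (if a = 0 then - 1 else 1) = (- 1::int)" for a :: nat by simp
    show "(\<Sum>b<q + 1. conference e a b * conference e c b) = (if a = c then int (q + 1) - 1 else 0)"
      if "a < q + 1" "c < q + 1" for a c using conference_orth[OF e that] by simp
  qed (assumption+, rule that)
  have "m > 0" if "q \<noteq> 3"
    using that m q by (cases "m = 0") auto
  moreover have "excess_bound (q + 1) = (if m = 0 then 8 else int (q + 1) * (2 * m + 1))"
  proof (cases "m = 0")
    case True
    then have "q + 1 = 4" using q by simp
    then show ?thesis using True excess_bound_order_4 by simp
  next
    case False
    then show ?thesis using excess_bound_eq[OF _ n] m by simp
  qed
  ultimately show ?thesis using that[OF RC(1,2,3)] RC(4,5) by simp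
qed

theorem theorem1p2:
  fixes m :: int and q n :: nat
  assumes "int q = 4 * m\<^sup>2 + 4 * m + 3"
    and "primepow q"
    and "n = q + 1"
  shows "(\<exists>H. hadamard_mat n H \<and> (q \<noteq> 3 \<longrightarrow> biregular H) \<and> excess H = excess_bound n) \<and>
    (\<forall>(F :: ('a, 'b) ring_scheme) e. field F \<and> bij_betw e {..<q} (carrier F) \<longrightarrow>
      (\<exists>R C. R \<subseteq> {..<n} \<and> C \<subseteq> {..<n} \<and>
        (let H' = negate_rows_cols R C (bordered_mat_of_field F q e)
         in hadamard_mat n H' \<and> (q \<noteq> 3 \<longrightarrow> biregular H') \<and> excess H' = excess_bound n)))"
proof -
  \<comment> \<open>The substitution m -> - 1 - m leaves q unchanged and makes a negative m
    nonnegative.\<close>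
  obtain m' :: int where m': "int q = 4 * m'\<^sup>2 + 4 * m' + 3" "m' \<ge> 0"
  proof (cases "m \<ge> 0")
    case True
    then show ?thesis using that assms(1) by blast
  next
    case False
    have "int q = 4 * (- 1 - m)\<^sup>2 + 4 * (- 1 - m) + 3"
      unfolding assms(1) by (simp add: power2_eq_square algebra_simps)
    then show ?thesis using that[of "- 1 - m"] False by simp
  qed
  note switch = bordered_mat_switching[OF m' assms(2)]
  \<comment> \<open>The first half needs a field on a concrete type, since the type variable of the
    second half need not carry any field with q elements.\<close>
  obtain F0 :: "((int list \<times> nat) multiset \<Rightarrow> int) ring" where F0: "field F0" "card (carrier F0) = q"
    using exists_finite_field_of_primepow_order[OF assms(2)] by blast
  have "q > 0" using assms(2) by (intro gr0I) simp
  then have "finite (carrier F0)" using F0(2) by (intro card_ge_0_finite) simp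
  then obtain e0 where e0: "bij_betw e0 {..<q} (carrier F0)"
    using ex_bij_betw_nat_finite F0(2) by (metis lessThan_atLeast0)
  have "\<exists>H. hadamard_mat n H \<and> (q \<noteq> 3 \<longrightarrow> biregular H) \<and> excess H = excess_bound n"
    by (rule switch[OF F0(1) e0]) (use assms(3) in blast)
  moreover have "\<exists>R C. R \<subseteq> {..<n} \<and> C \<subseteq> {..<n} \<and>
        (let H' = negate_rows_cols R C (bordered_mat_of_field F q e)
         in hadamard_mat n H' \<and> (q \<noteq> 3 \<longrightarrow> biregular H') \<and> excess H' = excess_bound n)"
    if "field F" "bij_betw e {..<q} (carrier F)" for F :: "('a, 'b) ring_scheme" and e
    by (rule switch[OF that]) (use assms(3) in \<open>unfold Let_def, blast\<close>)
  ultimately show ?thesis by blast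
qed

end
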